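(* Let $(\mathcal{S}^x,H)$ be a finite thick skew translation generalized quadrangle of order $(s,t)$ with group of symmetries $\mathbb{S}\le H$ about $x$, and put $T=H/\mathbb{S}$. Suppose that either $s=t$ is odd, or $s\neq t$ and property ( * ) holds. Then the only subgroup $M\le H$ with $M\mathbb{S}=H$ (i.e. projecting onto $T$) is $M=H$.
   Context: A finite generalized quadrangle (GQ) of order $(s,t)$: every line has $s+1$ points, every point is on $t+1$ lines, two points are on at most one common line, and for each point $p$ not on a line $L$ there is a unique point of $L$ collinear with $p$; thick means $s,t>1$. An elation generalized quadrangle $(\mathcal{S}^x,H)$: $H\le\mathrm{Aut}(\mathcal{S})$ fixes every line through $x$ and acts sharply transitively on the points not collinear with $x$. A symmetry about $x$ is an automorphism fixing every point collinear with $x$; the EGQ is a skew translation generalized quadrangle if $H$ contains a subgroup $\mathbb{S}$ of order $t$ of symmetries about $x$ ($\mathbb{S}\trianglelefteq H$). Property ( * ): whenever a point $y\neq x$ collinear with $x$ is fixed by some element $h\in H$, then $h$ fixes every point of the line $xy$. *)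

theory Defs
  imports "HOL-Algebra.Algebra"
begin

definition collinear :: "'p set set \<Rightarrow> 'p \<Rightarrow> 'p \<Rightarrow> bool" where
  "collinear L p q \<longleftrightarrow> (\<exists>l\<in>L. p \<in> l \<and> q \<in> l)"

definition GQ :: "'p set \<Rightarrow> 'p set set \<Rightarrow> nat \<Rightarrow> nat \<Rightarrow> bool" where
  "GQ P L s t \<longleftrightarrow>
     (\<forall>l\<in>L. l \<subseteq> P \<and> card l = s + 1) \<and>
     (\<forall>p\<in>P. card {l\<in>L. p \<in> l} = t + 1) \<and>
     (\<forall>p\<in>P. \<forall>q\<in>P. p \<noteq> q \<longrightarrow> card {l\<in>L. p \<in> l \<and> q \<in> l} \<le> 1) \<and>
     (\<forall>p\<in>P. \<forall>l\<in>L. p \<notin> l \<longrightarrow> (\<exists>!q. q \<in> l \<and> collinear L p q))"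

definition finite_thick_GQ :: "'p set \<Rightarrow> 'p set set \<Rightarrow> nat \<Rightarrow> nat \<Rightarrow> bool" where
  "finite_thick_GQ P L s t \<longleftrightarrow> finite P \<and> GQ P L s t \<and> s > 1 \<and> t > 1"

text \<open>Automorphisms: permutations of the point set (extensional, as elements of
  BijGroup P) mapping lines to lines.\<close>
definition GQ_aut :: "'p set \<Rightarrow> 'p set set \<Rightarrow> ('p \<Rightarrow> 'p) set" where
  "GQ_aut P L = {g \<in> Bij P. (\<forall>l. l \<subseteq> P \<longrightarrow> (g ` l \<in> L \<longleftrightarrow> l \<in> L))}"

definition elation_GQ :: "'p set \<Rightarrow> 'p set set \<Rightarrow> nat \<Rightarrow> nat \<Rightarrow> 'p \<Rightarrow> ('p \<Rightarrow> 'p) set \<Rightarrow> bool" where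
  "elation_GQ P L s t x H \<longleftrightarrow>
     finite_thick_GQ P L s t \<and> x \<in> P \<and>
     subgroup H (BijGroup P) \<and> H \<subseteq> GQ_aut P L \<and>
     (\<forall>h\<in>H. \<forall>l\<in>L. x \<in> l \<longrightarrow> h ` l = l) \<and>
     (\<forall>p\<in>P. \<forall>q\<in>P. \<not> collinear L x p \<longrightarrow> \<not> collinear L x q \<longrightarrow> (\<exists>!h. h \<in> H \<and> h p = q))"

definition symmetry_about :: "'p set \<Rightarrow> 'p set set \<Rightarrow> 'p \<Rightarrow> ('p \<Rightarrow> 'p) \<Rightarrow> bool" where
  "symmetry_about P L x g \<longleftrightarrow> g \<in> GQ_aut P L \<and> (\<forall>y\<in>P. collinear L x y \<longrightarrow> g y = y)"

definition skew_translation_GQ ::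
  "'p set \<Rightarrow> 'p set set \<Rightarrow> nat \<Rightarrow> nat \<Rightarrow> 'p \<Rightarrow> ('p \<Rightarrow> 'p) set \<Rightarrow> ('p \<Rightarrow> 'p) set \<Rightarrow> bool" where
  "skew_translation_GQ P L s t x H S \<longleftrightarrow>
     elation_GQ P L s t x H \<and> S \<subseteq> H \<and> subgroup S (BijGroup P) \<and>
     card S = t \<and> (\<forall>g\<in>S. symmetry_about P L x g) \<and>
     normal S ((BijGroup P)\<lparr>carrier := H\<rparr>)"

definition property_star :: "'p set \<Rightarrow> 'p set set \<Rightarrow> 'p \<Rightarrow> ('p \<Rightarrow> 'p) set \<Rightarrow> bool" where
  "property_star P L x H \<longleftrightarrow>
     (\<forall>y\<in>P. y \<noteq> x \<longrightarrow> collinear L x y \<longrightarrow>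
        (\<forall>h\<in>H. h y = y \<longrightarrow> (\<forall>l\<in>L. x \<in> l \<longrightarrow> y \<in> l \<longrightarrow> (\<forall>z\<in>l. h z = z))))"

end

theory Submission
  imports Defs "Jordan_Normal_Form.Schur_Decomposition"
begin

text \<open>Fix a point \<open>z\<close> not collinear with \<open>x\<close>. The stabilizers \<open>A\<^sub>i\<close> of the lines through \<open>z\<close> form a
  Kantor family of \<open>H\<close>, and \<open>B\<^sub>i = A\<^sub>i S\<close> is the stabilizer of the point of the \<open>i\<close>-th line collinear
  with \<open>x\<close>. All \<open>B\<^sub>i\<close> are normal (by property (*), or because the \<open>B\<^sub>i/S\<close> partition \<open>H/S\<close> if
  \<open>s = t\<close>), so \<open>H/S\<close> is abelian.

  The quadrangle axiom says that \<open>N = \<Sum>\<^sub>i A\<^sub>i\<close> satisfies \<open>N\<^sup>2 = (s + t) N\<close> modulo multiples of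
  \<open>S\<close>. Hence \<open>N (1 - S/t) / (s + t)\<close> is an idempotent of the group algebra, and the trace of an
  element of \<open>H\<close> on the corresponding module is a rational sum of roots of unity, so an integer. For
  an element of \<open>B\<^sub>i - S\<close> with no conjugate in \<open>A\<^sub>i\<close> this trace is \<open>-s\<^sup>2/(s + t)\<close>, which is not an integer
  under the hypotheses. So every \<open>h \<noteq> 1\<close> in \<open>A\<^sub>i\<close> is conjugate to its whole coset \<open>h S\<close>. If \<open>M S = H\<close>,
  counting shows that \<open>h\<close> fixes exactly one coset of \<open>M\<close>. As \<open>A\<^sub>i\<close> is abelian, it fixes one coset and
  acts semiregularly on the others; but \<open>A\<^sub>i\<close> has order \<open>s\<close> and there are at most \<open>t \<le> s\<close> cosets.\<close>

section \<open>Integrality of traces\<close>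

text \<open>Eigenvalues are roots of the characteristic polynomial, which is monic with integer
  coefficients.\<close>

lemma algebraic_int_eigenvalue_of_int_mat:
  fixes C :: "int mat" and k :: complex
  assumes C: "C \<in> carrier_mat n n" and ev: "eigenvalue (map_mat of_int C) k"
  shows "algebraic_int k"
proof -
  interpret of_int_hom: comm_ring_hom "of_int :: int \<Rightarrow> complex"
    by unfold_locales auto
  have "poly (char_poly (map_mat of_int C :: complex mat)) k = 0"
    using ev eigenvalue_root_char_poly[of "map_mat of_int C :: complex mat" n] C by auto
  hence "poly (map_poly of_int (char_poly C)) k = 0"
    unfolding of_int_hom.char_poly_hom[OF C] .
  moreover have "lead_coeff (char_poly C) = 1"
    using degree_monic_char_poly[OF C] by simp
  ultimately show ?thesis
    unfolding algebraic_int_altdef_ipoly by blast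
qed

text \<open>The element is an eigenvalue of the circulant matrix with entries \<open>c\<close>, with eigenvector
  \<open>(1, z, z\<^sup>2, \<dots>)\<close>.\<close>

lemma algebraic_int_root_of_unity_sum:
  fixes z :: complex and c :: "nat \<Rightarrow> int"
  assumes n: "n > 0" and z: "z ^ n = 1"
  shows "algebraic_int (\<Sum>j<n. of_int (c j) * z ^ j)" (is "algebraic_int ?a")
proof -
  \<comment> \<open>The added \<open>n\<close> prevents the subtraction of natural numbers from
    truncating: the index is k - i modulo \<open>n\<close>.\<close>
  define C :: "int mat" where "C = mat n n (\<lambda>(i, k). c ((k + n - i) mod n))"
  define v where "v = vec n (\<lambda>k. z ^ k)"
  have zmod: "z ^ (m mod n) = z ^ m" for m
  proof -
    have "z ^ m = z ^ (n * (m div n) + m mod n)" by simp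
    also have "\<dots> = z ^ (m mod n)" by (simp only: power_add power_mult z) simp
    finally show ?thesis by simp
  qed
  \<comment> \<open>Coordinate \<open>i\<close> of the eigenvector equation; substituting j = k - i
    modulo \<open>n\<close> pulls out the factor \<open>z ^ i\<close>.\<close>
  have row: "(\<Sum>k<n. of_int (c ((k + n - i) mod n)) * z ^ k) = ?a * z ^ i" if i: "i < n" for i
  proof -
    have "(\<Sum>k<n. of_int (c ((k + n - i) mod n)) * z ^ k)
        = (\<Sum>j<n. of_int (c j) * z ^ ((j + i) mod n))"
    proof (rule sum.reindex_bij_witness[of _ "\<lambda>j. (j + i) mod n" "\<lambda>k. (k + n - i) mod n"])
      fix k assume k: "k \<in> {..<n}"
      have "((k + n - i) mod n + i) mod n = (k + n - i + i) mod n" by (simp add: mod_add_left_eq)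
      also have "\<dots> = k" using i k by simp
      finally show e: "((k + n - i) mod n + i) mod n = k" .
      show "(k + n - i) mod n \<in> {..<n}" using n by simp
      show "of_int (c ((k + n - i) mod n)) * z ^ (((k + n - i) mod n + i) mod n)
          = of_int (c ((k + n - i) mod n)) * z ^ k" by (simp only: e)
    next
      fix j assume j: "j \<in> {..<n}"
      show "(j + i) mod n \<in> {..<n}" using n by simp
      have "((j + i) mod n + n - i) mod n = j"
      proof (cases "j + i < n")
        case True thus ?thesis using j by simp
      next
        case False
        hence "(j + i) mod n = j + i - n" using i j by (simp add: mod_if)
        thus ?thesis using False j i by simp
      qed
      thus "((j + i) mod n + n - i) mod n = j" .
    qed
    also have "\<dots> = (\<Sum>j<n. of_int (c j) * z ^ j * z ^ i)"
      by (simp add: zmod power_add mult.assoc)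
    also have "\<dots> = ?a * z ^ i" by (simp add: sum_distrib_right)
    finally show ?thesis .
  qed
  have C: "C \<in> carrier_mat n n" by (simp add: C_def)
  have "map_mat of_int C *\<^sub>v v = ?a \<cdot>\<^sub>v v"
  proof (rule eq_vecI)
    fix i assume "i < dim_vec (?a \<cdot>\<^sub>v v)"
    hence i: "i < n" by (simp add: v_def)
    have "(map_mat of_int C *\<^sub>v v) $ i = (\<Sum>k<n. of_int (c ((k + n - i) mod n)) * z ^ k)"
      using i by (simp add: C_def v_def scalar_prod_def atLeast0LessThan)
    also have "\<dots> = (?a \<cdot>\<^sub>v v) $ i" using row[OF i] i by (simp add: v_def)
    finally show "(map_mat of_int C *\<^sub>v v) $ i = (?a \<cdot>\<^sub>v v) $ i" .
  qed (simp add: C_def v_def)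
  moreover have "v \<noteq> 0\<^sub>v n"
  proof
    assume "v = 0\<^sub>v n"
    hence "v $ 0 = 0" using n by simp
    thus False using n by (simp add: v_def)
  qed
  ultimately have "eigenvalue (map_mat of_int C) ?a"
    unfolding eigenvalue_def eigenvector_def using C by (intro exI[of _ v]) (auto simp: v_def)
  thus ?thesis by (rule algebraic_int_eigenvalue_of_int_mat[OF C])
qed

lemma trace_mult_comm:
  fixes A B :: "'a :: comm_ring_1 mat"
  assumes "A \<in> carrier_mat n n" "B \<in> carrier_mat n n"
  shows "(\<Sum>i<n. (A * B) $$ (i, i)) = (\<Sum>i<n. (B * A) $$ (i, i))"
proof -
  have "(\<Sum>i<n. (A * B) $$ (i, i)) = (\<Sum>i<n. \<Sum>j<n. A $$ (i, j) * B $$ (j, i))"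
    using assms by (simp add: scalar_prod_def atLeast0LessThan)
  also have "\<dots> = (\<Sum>j<n. \<Sum>i<n. A $$ (i, j) * B $$ (j, i))" by (rule sum.swap)
  also have "\<dots> = (\<Sum>i<n. (B * A) $$ (i, i))"
    using assms by (simp add: scalar_prod_def atLeast0LessThan mult.commute)
  finally show ?thesis .
qed

text \<open>A Schur decomposition makes \<open>A\<close> similar to a matrix with diagonal
  \<open>es\<close>, and commuting factors under the trace removes the similarity.\<close>

lemma trace_eq_sum_eigenvalues:
  fixes A :: "complex mat"
  assumes A: "A \<in> carrier_mat n n" and es: "char_poly A = (\<Prod>a\<leftarrow>es. [:- a, 1:])"
  shows "(\<Sum>i<n. A $$ (i, i)) = sum_list es"
proof -
  obtain B P Q where "schur_decomposition A es = (B, P, Q)"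
    by (cases "schur_decomposition A es") auto
  from schur_decomposition[OF A es this]
  have w: "similar_mat_wit A B P Q" and d: "diag_mat B = es" by auto
  note w = similar_mat_witD2[OF A w]
  have "(\<Sum>i<n. A $$ (i, i)) = (\<Sum>i<n. (P * (B * Q)) $$ (i, i))"
    using w by (simp add: assoc_mult_mat)
  also have "\<dots> = (\<Sum>i<n. (B * Q * P) $$ (i, i))"
    using w by (intro trace_mult_comm) auto
  also have "B * Q * P = B" using w by (simp add: assoc_mult_mat)
  also have "(\<Sum>i<n. B $$ (i, i)) = sum_list (diag_mat B)"
    using w by (simp add: diag_mat_def interv_sum_list_conv_sum_set_nat atLeast0LessThan)
  finally show ?thesis using d by simp
qed

text \<open>The eigenvalues are 0 or \<open>n\<close>-th roots of unity. Hence the trace is an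
  integral combination of powers of one primitive root, so an algebraic integer, and rational
  algebraic integers are integers.\<close>

lemma trace_integer_if_power_fixes:
  fixes A :: "complex mat"
  assumes A: "A \<in> carrier_mat N N" and n: "n > 0" and pow: "A ^\<^sub>m Suc n = A"
    and rat: "(\<Sum>i<N. A $$ (i, i)) \<in> \<rat>"
  shows "(\<Sum>i<N. A $$ (i, i)) \<in> \<int>"
proof -
  obtain es where es: "char_poly A = (\<Prod>a\<leftarrow>es. [:- a, 1:])"
    using char_poly_factorized[OF A] by blast
  define z where "z = cis (2 * pi / n)"
  have z: "z ^ n = 1" using n by (simp add: z_def DeMoivre)
  have root: "\<exists>c. (e :: complex) = (\<Sum>j<n. of_int (c j) * z ^ j)" if e: "e \<in> set es" for e
  proof -
    have "poly (char_poly A) e = 0"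
      unfolding es poly_prod_list using e by (force simp: prod_list_zero_iff)
    then obtain v where v: "eigenvector A v e"
      using eigenvalue_root_char_poly[OF A] unfolding eigenvalue_def by auto
    hence vc: "v \<in> carrier_vec N" "v \<noteq> 0\<^sub>v N" "A *\<^sub>v v = e \<cdot>\<^sub>v v"
      using A unfolding eigenvector_def by auto
    have "e ^ Suc n \<cdot>\<^sub>v v = e \<cdot>\<^sub>v v"
      using eigenvector_pow[OF A v, of "Suc n"] pow vc(3) by simp
    moreover obtain i where "i < N" "v $ i \<noteq> 0"
      using vc(1,2) by (metis carrier_vecD eq_vecI index_zero_vec(1) index_zero_vec(2))
    ultimately have "e ^ Suc n = e"
      using vc(1) by (metis carrier_vecD index_smult_vec(1) mult_cancel_right)
    hence "e = 0 \<or> e ^ n = 1" by simp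
    thus ?thesis
    proof
      assume "e = 0"
      thus ?thesis by (intro exI[of _ "\<lambda>_. 0"]) simp
    next
      assume "e ^ n = 1"
      then obtain k where k: "k < n" "e = cis (2 * pi * real k / real n)"
        using bij_betw_roots_unity[OF n] unfolding bij_betw_def by auto
      have "e = z ^ k" unfolding z_def k(2) DeMoivre by (simp add: mult_ac)
      moreover have "(\<Sum>j<n. of_int (if j = k then 1 else 0) * z ^ j) = z ^ k"
        using k(1) by (simp add: if_distrib[of of_int] if_distrib[of "\<lambda>x. x * _"] cong: if_cong)
      ultimately show ?thesis by (intro exI[of _ "\<lambda>j. if j = k then 1 else 0"]) simp
    qed
  qed
  \<comment> \<open>All eigenvalues are expressed in powers of the same \<open>z\<close>, so their
    coefficient functions can simply be added.\<close>
  have "\<exists>c. (sum_list es :: complex) = (\<Sum>j<n. of_int (c j) * z ^ j)" using root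
  proof (induction es)
    case Nil
    show ?case by (intro exI[of _ "\<lambda>_. 0"]) simp
  next
    case (Cons e es)
    obtain c where "e = (\<Sum>j<n. of_int (c j) * z ^ j)" using Cons.prems[of e] by auto
    moreover obtain d where "sum_list es = (\<Sum>j<n. of_int (d j) * z ^ j)"
      using Cons by auto
    ultimately show ?case
      by (intro exI[of _ "\<lambda>j. c j + d j"]) (simp add: sum.distrib ring_distribs)
  qed
  then obtain c where "sum_list es = (\<Sum>j<n. of_int (c j) * z ^ j)" by blast
  hence "algebraic_int (sum_list es)"
    using algebraic_int_root_of_unity_sum[OF n z] by simp
  thus ?thesis using rational_algebraic_int_is_int rat trace_eq_sum_eigenvalues[OF A es] by metis
qed

section \<open>Traces attached to idempotents of the group algebra\<close>

context group
begin

lemma inv_cancel_left [simp]: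
  assumes "x \<in> carrier G" "y \<in> carrier G"
  shows "x \<otimes> (inv x \<otimes> y) = y" and "inv x \<otimes> (x \<otimes> y) = y"
  using assms by (simp_all flip: m_assoc)

text \<open>Up to \<open>K\<close>, the matrix below is the regular representation of an idempotent of the group
  algebra, hence has powers given by the powers of \<open>K\<close>.\<close>

lemma trace_translated_idempotent_integer:
  fixes e :: "'a \<Rightarrow> complex"
  assumes fin: "finite (carrier G)" and K: "K \<in> carrier G"
    and idem: "\<And>x. x \<in> carrier G \<Longrightarrow> (\<Sum>u\<in>carrier G. e u * e (inv u \<otimes> x)) = e x"
    and rat: "(\<Sum>g\<in>carrier G. e (inv g \<otimes> K \<otimes> g)) \<in> \<rat>"
  shows "(\<Sum>g\<in>carrier G. e (inv g \<otimes> K \<otimes> g)) \<in> \<int>"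
proof -
  define N where "N = card (carrier G)"
  obtain f where f: "bij_betw f {..<N} (carrier G)"
    using ex_bij_betw_nat_finite[OF fin] by (auto simp: N_def atLeast0LessThan)
  have fG: "f a \<in> carrier G" if "a < N" for a
    using f that by (auto simp: bij_betw_def)
  \<comment> \<open>\<open>A J\<close> is the convolution matrix of \<open>e\<close> with its rows
    permuted by left translation with \<open>J\<close>.\<close>
  define A where "A J = mat N N (\<lambda>(a, b). e (inv (f a) \<otimes> J \<otimes> f b))" for J
  have Ac: "A J \<in> carrier_mat N N" for J by (simp add: A_def)
  have mult: "A J * A J' = A (J \<otimes> J')" if J: "J \<in> carrier G" "J' \<in> carrier G" for J J'
  proof (rule eq_matI)
    fix a b assume "a < dim_row (A (J \<otimes> J'))" "b < dim_col (A (J \<otimes> J'))"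
    hence ab: "a < N" "b < N" by (auto simp: A_def)
    note cl = fG[OF ab(1)] fG[OF ab(2)] J
    have "(A J * A J') $$ (a, b)
        = (\<Sum>k<N. e (inv (f a) \<otimes> J \<otimes> f k) * e (inv (f k) \<otimes> J' \<otimes> f b))"
      using ab by (simp add: A_def scalar_prod_def atLeast0LessThan)
    also have "\<dots> = (\<Sum>h\<in>carrier G. e (inv (f a) \<otimes> J \<otimes> h) * e (inv h \<otimes> J' \<otimes> f b))"
      by (rule sum.reindex_bij_betw[OF f])
    \<comment> \<open>Putting \<open>u = inv (f a) \<otimes> J \<otimes> h\<close> turns the sum
      into a value of the convolution square of \<open>e\<close>, to which \<open>idem\<close>
      applies.\<close>
    also have "\<dots> = (\<Sum>u\<in>carrier G. e u * e (inv u \<otimes> (inv (f a) \<otimes> (J \<otimes> J') \<otimes> f b)))"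
    proof (rule sum.reindex_bij_witness[of _ "\<lambda>u. inv J \<otimes> f a \<otimes> u" "\<lambda>h. inv (f a) \<otimes> J \<otimes> h"])
      fix h assume h: "h \<in> carrier G"
      show "inv J \<otimes> f a \<otimes> (inv (f a) \<otimes> J \<otimes> h) = h"
        using h cl by (simp add: m_assoc)
      show "inv (f a) \<otimes> J \<otimes> h \<in> carrier G" using h cl by simp
      have "inv (inv (f a) \<otimes> J \<otimes> h) \<otimes> (inv (f a) \<otimes> (J \<otimes> J') \<otimes> f b) = inv h \<otimes> J' \<otimes> f b"
        using h cl by (simp add: inv_mult_group m_assoc)
      thus "e (inv (f a) \<otimes> J \<otimes> h) * e (inv (inv (f a) \<otimes> J \<otimes> h) \<otimes> (inv (f a) \<otimes> (J \<otimes> J') \<otimes> f b))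
          = e (inv (f a) \<otimes> J \<otimes> h) * e (inv h \<otimes> J' \<otimes> f b)" by simp
    next
      fix u assume u: "u \<in> carrier G"
      show "inv (f a) \<otimes> J \<otimes> (inv J \<otimes> f a \<otimes> u) = u"
        using u cl by (simp add: m_assoc)
      show "inv J \<otimes> f a \<otimes> u \<in> carrier G" using u cl by simp
    qed
    also have "\<dots> = e (inv (f a) \<otimes> (J \<otimes> J') \<otimes> f b)" using cl by (intro idem) simp
    also have "\<dots> = A (J \<otimes> J') $$ (a, b)" using ab by (simp add: A_def)
    finally show "(A J * A J') $$ (a, b) = A (J \<otimes> J') $$ (a, b)" .
  qed (auto simp: A_def)
  \<comment> \<open>Exponents start at one: the zeroth power is the identity matrix, whereas
    \<open>A \<one>\<close> is in general only an idempotent.\<close>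
  have pow: "A K ^\<^sub>m Suc j = A (K [^] Suc j)" for j
  proof (induction j)
    case 0
    show ?case using K Ac[of K] by simp
  next
    case (Suc j)
    have "A K ^\<^sub>m Suc (Suc j) = A (K [^] Suc j) * A K" using Suc by simp
    also have "\<dots> = A (K [^] Suc (Suc j))" using K by (subst mult) auto
    finally show ?case .
  qed
  have "K [^] Suc (Coset.order G) = K" using K pow_order_eq_1[OF K] by simp
  hence "A K ^\<^sub>m Suc (Coset.order G) = A K" by (simp only: pow)
  moreover have "Coset.order G > 0" using fin by (simp add: order_gt_0_iff_finite)
  moreover have "(\<Sum>i<N. A K $$ (i, i)) = (\<Sum>g\<in>carrier G. e (inv g \<otimes> K \<otimes> g))"
    by (subst sum.reindex_bij_betw[OF f, symmetric]) (simp add: A_def)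
  ultimately show ?thesis
    using trace_integer_if_power_fixes[OF Ac] rat by metis
qed

end

section \<open>Kantor families\<close>

context group
begin

lemma subgroup_inv_mult_mem_iff:
  assumes "subgroup Q G" "u \<in> Q" "x \<in> carrier G"
  shows "inv u \<otimes> x \<in> Q \<longleftrightarrow> x \<in> Q"
proof
  interpret Q: subgroup Q G by fact
  show "x \<in> Q" if "inv u \<otimes> x \<in> Q"
    using Q.m_closed[OF assms(2) that] assms(2,3) by simp
  show "inv u \<otimes> x \<in> Q" if "x \<in> Q"
    using that assms(2) by blast
qed

text \<open>The number of factorisations of \<open>x\<close> in \<open>P Q\<close> is at most \<open>|P \<inter> Q|\<close>, and the average over
  all \<open>x\<close> attains this bound.\<close>

lemma card_factorizations_subgroups:
  assumes fin: "finite (carrier G)" and P: "subgroup P G" and Q: "subgroup Q G"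
    and card: "card P * card Q = card (carrier G) * card (P \<inter> Q)" and x: "x \<in> carrier G"
  shows "card {u \<in> P. inv u \<otimes> x \<in> Q} = card (P \<inter> Q)"
proof -
  interpret P: subgroup P G by fact
  interpret Q: subgroup Q G by fact
  have finP: "finite P" using fin P.subset finite_subset by blast
  define n where "n y = card {u \<in> P. inv u \<otimes> y \<in> Q}" for y
  \<comment> \<open>Dividing by the first factor \<open>u0\<close> of one factorisation sends all of
    them injectively into \<open>P \<inter> Q\<close>.\<close>
  have le: "n y \<le> card (P \<inter> Q)" if y: "y \<in> carrier G" for y
  proof (cases "{u \<in> P. inv u \<otimes> y \<in> Q} = {}")
    case False
    then obtain u0 where u0: "u0 \<in> P" "inv u0 \<otimes> y \<in> Q" by blast
    show ?thesis unfolding n_def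
    proof (rule card_inj_on_le[where f = "\<lambda>u. inv u0 \<otimes> u"])
      show "inj_on (\<lambda>u. inv u0 \<otimes> u) {u \<in> P. inv u \<otimes> y \<in> Q}"
        using u0 by (intro inj_onI) simp
      have "inv u0 \<otimes> u \<in> Q" if "u \<in> P" "inv u \<otimes> y \<in> Q" for u
      proof -
        have "(inv u0 \<otimes> y) \<otimes> inv (inv u \<otimes> y) \<in> Q" using u0 that by blast
        thus ?thesis using that u0 y by (simp add: inv_mult_group m_assoc)
      qed
      thus "(\<lambda>u. inv u0 \<otimes> u) ` {u \<in> P. inv u \<otimes> y \<in> Q} \<subseteq> P \<inter> Q" using u0 by auto
    qed (use finP in simp)
  next
    case True thus ?thesis by (simp only: n_def card.empty)
  qed
  \<comment> \<open>Double counting: each \<open>u\<close> in \<open>P\<close> is a first factor for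
    exactly \<open>card Q\<close> elements \<open>y\<close>, and by \<open>card\<close> the total
    equals the sum of the upper bounds.\<close>
  have "(\<Sum>y\<in>carrier G. n y) = (\<Sum>y\<in>carrier G. \<Sum>u\<in>P. of_bool (inv u \<otimes> y \<in> Q))"
    using finP by (simp add: n_def Collect_conj_eq Int_commute)
  also have "\<dots> = (\<Sum>u\<in>P. \<Sum>y\<in>carrier G. of_bool (inv u \<otimes> y \<in> Q))"
    by (rule sum.swap)
  also have "\<dots> = (\<Sum>u\<in>P. card Q)"
  proof (rule sum.cong)
    fix u assume u: "u \<in> P"
    have "(\<Sum>y\<in>carrier G. of_bool (inv u \<otimes> y \<in> Q) :: nat)
        = card {y \<in> carrier G. inv u \<otimes> y \<in> Q}"
      using fin by (simp add: Collect_conj_eq Int_commute)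
    also have "\<dots> = card Q"
      by (rule bij_betw_same_card[OF bij_betw_byWitness[where f = "\<lambda>y. inv u \<otimes> y" and f' = "\<lambda>q. u \<otimes> q"]])
        (use u in auto)
    finally show "(\<Sum>y\<in>carrier G. of_bool (inv u \<otimes> y \<in> Q)) = card Q" .
  qed simp
  also have "\<dots> = (\<Sum>y\<in>carrier G. card (P \<inter> Q))" using card by simp
  finally have eq: "(\<Sum>y\<in>carrier G. n y) = (\<Sum>y\<in>carrier G. card (P \<inter> Q))" .
  have "n x = card (P \<inter> Q)"
  proof (rule ccontr)
    assume "n x \<noteq> card (P \<inter> Q)"
    hence "n x < card (P \<inter> Q)" using le[OF x] by simp
    hence "(\<Sum>y\<in>carrier G. n y) < (\<Sum>y\<in>carrier G. card (P \<inter> Q))"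
      using le x fin by (intro sum_strict_mono_ex1) auto
    thus False using eq by simp
  qed
  thus ?thesis by (simp add: n_def)
qed

end

text \<open>\<open>factor\<close> is the projection axiom of the quadrangle in group form: existence
  and uniqueness of the projection of a point onto the line belonging to \<open>A i\<close>,
  together with the joining line. It also determines the order of \<open>G\<close>.\<close>

locale kantor_family = group G for G (structure) +
  fixes S :: "'a set" and I :: "'i set" and A :: "'i \<Rightarrow> 'a set" and s t :: nat
  assumes fin: "finite (carrier G)"
    and S_normal: "S \<lhd> G" and card_S: "card S = t"
    and card_I: "card I = t + 1"
    and A_sub: "i \<in> I \<Longrightarrow> subgroup (A i) G"
    and card_A: "i \<in> I \<Longrightarrow> card (A i) = s"
    and A_S: "i \<in> I \<Longrightarrow> A i \<inter> S = {\<one>}"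
    and A_A: "i \<in> I \<Longrightarrow> j \<in> I \<Longrightarrow> i \<noteq> j \<Longrightarrow> (A i <#> S) \<inter> A j = {\<one>}"
    and factor: "i \<in> I \<Longrightarrow> g \<in> carrier G \<Longrightarrow> g \<notin> A i <#> S \<Longrightarrow>
      card {(j, a). j \<in> I - {i} \<and> a \<in> A i \<and> inv a \<otimes> g \<in> A j} = 1"
    and s_gt: "s > 1" and t_gt: "t > 1"
begin

text \<open>The tangent subgroup belonging to \<open>A i\<close>; all of them arise from the one
  normal subgroup \<open>S\<close>.\<close>

definition B :: "'i \<Rightarrow> 'a set" where "B i = A i <#> S"

section \<open>Elementary properties and orders of the subgroups\<close>

lemma finite_I: "finite I" using card_I card.infinite by fastforce

lemma S_sub: "subgroup S G" using S_normal normal_imp_subgroup by blast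

lemma A_carrier: "i \<in> I \<Longrightarrow> A i \<subseteq> carrier G" using A_sub subgroup.subset by blast

lemma S_carrier: "S \<subseteq> carrier G" using S_sub subgroup.subset by blast

lemma finite_A: "i \<in> I \<Longrightarrow> finite (A i)" using A_carrier fin finite_subset by blast

lemma one_A: "i \<in> I \<Longrightarrow> \<one> \<in> A i" using A_sub subgroup.one_closed by blast

lemma one_S: "\<one> \<in> S" using S_sub subgroup.one_closed by blast

lemma mem_B: "b \<in> B i \<longleftrightarrow> (\<exists>a\<in>A i. \<exists>\<sigma>\<in>S. b = a \<otimes> \<sigma>)"
  by (auto simp: B_def set_mult_def)

lemma B_sub: "i \<in> I \<Longrightarrow> subgroup (B i) G"
  using mult_norm_subgroup[OF S_normal A_sub] commut_normal[OF A_sub S_normal] by (simp add: B_def)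

lemma B_carrier: "i \<in> I \<Longrightarrow> B i \<subseteq> carrier G" using B_sub subgroup.subset by blast

lemma finite_B: "i \<in> I \<Longrightarrow> finite (B i)" using B_carrier fin finite_subset by blast

lemma A_subset_B: "i \<in> I \<Longrightarrow> A i \<subseteq> B i"
  using one_S A_carrier by (force simp: mem_B)

lemma S_subset_B: "i \<in> I \<Longrightarrow> S \<subseteq> B i"
  using one_A S_carrier by (force simp: mem_B)

lemma B_inter_A: "i \<in> I \<Longrightarrow> j \<in> I \<Longrightarrow> i \<noteq> j \<Longrightarrow> B i \<inter> A j = {\<one>}"
  using A_A by (simp add: B_def)

text \<open>If a product of \<open>a\<close> in \<open>A j\<close> and an element of
  \<open>S\<close> lies in \<open>B i\<close>, then so does \<open>a\<close>, because
  \<open>B i\<close> contains \<open>S\<close>; hence \<open>a\<close> is trivial.\<close>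

lemma B_inter:
  assumes "i \<in> I" "j \<in> I" "i \<noteq> j"
  shows "B i \<inter> B j = S"
proof
  show "S \<subseteq> B i \<inter> B j" using S_subset_B assms by blast
  show "B i \<inter> B j \<subseteq> S"
  proof
    fix x assume x: "x \<in> B i \<inter> B j"
    then obtain a \<sigma> where a: "a \<in> A j" "\<sigma> \<in> S" "x = a \<otimes> \<sigma>" by (auto simp: mem_B)
    interpret Bi: subgroup "B i" G using B_sub assms by blast
    have "\<sigma> \<in> B i" using S_subset_B a assms by blast
    hence "x \<otimes> inv \<sigma> \<in> B i" using x by blast
    moreover have "x \<otimes> inv \<sigma> = a"
      using a A_carrier[OF assms(2)] S_carrier by (auto simp: m_assoc subset_iff)
    ultimately have "a = \<one>" using B_inter_A[OF assms] a by blast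
    thus "x \<in> S" using a S_carrier by auto
  qed
qed

lemma card_B:
  assumes i: "i \<in> I"
  shows "card (B i) = s * t"
proof -
  interpret A: subgroup "A i" G using A_sub i .
  interpret S: subgroup S G using S_sub .
  have "bij_betw (\<lambda>(a, \<sigma>). a \<otimes> \<sigma>) (A i \<times> S) (B i)"
    unfolding bij_betw_def
  proof
    show "inj_on (\<lambda>(a, \<sigma>). a \<otimes> \<sigma>) (A i \<times> S)"
    proof (intro inj_onI, clarify)
      fix a \<sigma> b \<tau> assume h: "a \<in> A i" "\<sigma> \<in> S" "b \<in> A i" "\<tau> \<in> S" "a \<otimes> \<sigma> = b \<otimes> \<tau>"
      have "inv b \<otimes> a = inv b \<otimes> (a \<otimes> \<sigma>) \<otimes> inv \<sigma>" using h(1-4) by (simp add: m_assoc)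
      also have "\<dots> = \<tau> \<otimes> inv \<sigma>" using h(1-4) unfolding h(5) by simp
      finally have "inv b \<otimes> a = \<tau> \<otimes> inv \<sigma>" .
      moreover have "inv b \<otimes> a \<in> A i" "\<tau> \<otimes> inv \<sigma> \<in> S" using h by blast+
      ultimately have "inv b \<otimes> a = \<one>" using A_S[OF i] by auto
      hence "a = b" using h by (metis A.mem_carrier inv_cancel_left(1) r_one)
      thus "a = b \<and> \<sigma> = \<tau>" using h by simp
    qed
    show "(\<lambda>(a, \<sigma>). a \<otimes> \<sigma>) ` (A i \<times> S) = B i" by (force simp: mem_B)
  qed
  from bij_betw_same_card[OF this] show ?thesis
    using card_A[OF i] card_S by (simp add: card_cartesian_product)
qed

lemma two_indices:
  obtains i j where "i \<in> I" "j \<in> I" "i \<noteq> j"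
proof -
  have "card I > 1" using card_I t_gt by simp
  thus ?thesis using that by (metis card_le_Suc0_iff_eq finite_I One_nat_def not_less)
qed

lemma third_index:
  assumes "i \<in> I" "j \<in> I"
  obtains k where "k \<in> I" "k \<noteq> i" "k \<noteq> j"
proof -
  have "card {i, j} \<le> 2" by (simp add: card_insert_if)
  hence "\<not> I \<subseteq> {i, j}" using card_I t_gt card_mono[of "{i, j}" I] by force
  thus ?thesis using that by blast
qed

text \<open>By \<open>factor\<close>, an element outside \<open>B i\<close> is uniquely a product of
  some \<open>a\<close> in \<open>A i\<close> and a nontrivial \<open>b\<close> in some
  \<open>A j\<close> with \<open>j \<noteq> i\<close>. So the order is
  \<open>s * t + s * (t * (s - 1))\<close>.\<close>

lemma card_G: "card (carrier G) = s\<^sup>2 * t"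
proof -
  obtain i j0 where i: "i \<in> I" and "j0 \<in> I" "i \<noteq> j0" by (rule two_indices)
  interpret Ai: subgroup "A i" G using A_sub i .
  interpret Bi: subgroup "B i" G using B_sub i .
  have "bij_betw (\<lambda>(a, j, b). a \<otimes> b) (A i \<times> Sigma (I - {i}) (\<lambda>j. A j - {\<one>})) (carrier G - B i)"
    unfolding bij_betw_def
  proof
    have notin: "a \<otimes> b \<notin> B i" if "a \<in> A i" "j \<in> I - {i}" "b \<in> A j - {\<one>}" for a b j
    proof
      assume "a \<otimes> b \<in> B i"
      hence "inv a \<otimes> (a \<otimes> b) \<in> B i" using that A_subset_B i by blast
      moreover have "b \<in> carrier G" using that A_carrier by blast
      ultimately have "b \<in> B i" using that by simp
      thus False using B_inter_A[OF i, of j] that by blast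
    qed
    show "inj_on (\<lambda>(a, j, b). a \<otimes> b) (A i \<times> Sigma (I - {i}) (\<lambda>j. A j - {\<one>}))"
    proof (rule inj_onI)
      fix p p'
      assume pX: "p \<in> A i \<times> Sigma (I - {i}) (\<lambda>j. A j - {\<one>})" "p' \<in> A i \<times> Sigma (I - {i}) (\<lambda>j. A j - {\<one>})"
        and pp: "(case p of (a, j, b) \<Rightarrow> a \<otimes> b) = (case p' of (a, j, b) \<Rightarrow> a \<otimes> b)"
      obtain a j b a' j' b' where p: "p = (a, j, b)" "p' = (a', j', b')" by (metis prod_cases3)
      have eq: "a \<otimes> b = a' \<otimes> b'" using pp unfolding p by simp
      have h: "a \<in> A i" "j \<in> I" "b \<in> A j" "b \<noteq> \<one>" "j \<noteq> i"
        "a' \<in> A i" "j' \<in> I" "b' \<in> A j'" "b' \<noteq> \<one>" "j' \<noteq> i"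
        using pX unfolding p by blast+
      have bc: "b \<in> carrier G" "b' \<in> carrier G" using h A_carrier by blast+
      have "a \<otimes> b \<notin> A i <#> S" using notin[of a j b] h(1-5) by (simp add: B_def)
      \<comment> \<open>Two factorisations of one element give two members of a singleton, so index
        and first factor agree, and then the second factor does too.\<close>
      hence "card {(j', a'). j' \<in> I - {i} \<and> a' \<in> A i \<and> inv a' \<otimes> (a \<otimes> b) \<in> A j'} = 1"
        using h(1) bc(1) i by (intro factor) auto
      then obtain q where q: "{(j', a'). j' \<in> I - {i} \<and> a' \<in> A i \<and> inv a' \<otimes> (a \<otimes> b) \<in> A j'} = {q}"
        by (rule card_1_singletonE)
      have e: "inv a \<otimes> (a \<otimes> b) = b" using h(1) bc(1) by simp
      have e': "inv a' \<otimes> (a \<otimes> b) = b'" unfolding eq using h(6) bc(2) by simp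
      have "(j, a) \<in> {(j', a'). j' \<in> I - {i} \<and> a' \<in> A i \<and> inv a' \<otimes> (a \<otimes> b) \<in> A j'}"
        unfolding mem_Collect_eq prod.case e using h by blast
      moreover have "(j', a') \<in> {(j', a'). j' \<in> I - {i} \<and> a' \<in> A i \<and> inv a' \<otimes> (a \<otimes> b) \<in> A j'}"
        unfolding mem_Collect_eq prod.case e' using h by blast
      ultimately have ja: "(j, a) = (j', a')" unfolding q by simp
      moreover have "b = b'" using e e' ja by simp
      ultimately show "p = p'" unfolding p by simp
    qed
    show "(\<lambda>(a, j, b). a \<otimes> b) ` (A i \<times> Sigma (I - {i}) (\<lambda>j. A j - {\<one>})) = carrier G - B i" (is "?l = ?r")
    proof
      have "a \<otimes> b \<in> carrier G" if "a \<in> A i" "j \<in> I - {i}" "b \<in> A j - {\<one>}" for a b j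
        using that A_carrier i by blast
      thus "?l \<subseteq> ?r" using notin by auto
      show "?r \<subseteq> ?l"
      proof
        fix g assume g: "g \<in> ?r"
        hence "card {(j, a). j \<in> I - {i} \<and> a \<in> A i \<and> inv a \<otimes> g \<in> A j} = 1"
          using i by (intro factor) (auto simp: B_def)
        hence "{(j, a). j \<in> I - {i} \<and> a \<in> A i \<and> inv a \<otimes> g \<in> A j} \<noteq> {}"
          by (intro notI) (simp only: card.empty)
        then obtain j a where ja: "j \<in> I - {i}" "a \<in> A i" "inv a \<otimes> g \<in> A j" by blast
        have "inv a \<otimes> g \<noteq> \<one>"
        proof
          assume "inv a \<otimes> g = \<one>"
          hence "g = a" using g ja by (metis Ai.mem_carrier DiffD1 inv_cancel_left(1) r_one)
          thus False using g ja A_subset_B[OF i] by blast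
        qed
        thus "g \<in> ?l" using ja g by (intro image_eqI[of _ _ "(a, j, inv a \<otimes> g)"]) auto
      qed
    qed
  qed
  from bij_betw_same_card[OF this]
  have "card (carrier G - B i) = s * (\<Sum>j\<in>I - {i}. card (A j - {\<one>}))"
    using finite_I finite_A by (simp add: card_cartesian_product card_A[OF i])
  also have "(\<Sum>j\<in>I - {i}. card (A j - {\<one>})) = (\<Sum>j\<in>I - {i}. s - 1)"
    by (intro sum.cong) (auto simp: card_A one_A finite_A card_Diff_singleton)
  also have "\<dots> = t * (s - 1)" using card_I i finite_I by simp
  finally have "card (carrier G) - s * t = s * (t * (s - 1))"
    using card_Diff_subset[OF finite_B B_carrier, OF i i] card_B[OF i] by simp
  moreover have "card (carrier G) \<ge> s * t"
    using card_mono[OF fin B_carrier[OF i]] card_B[OF i] by simp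
  ultimately have "card (carrier G) = s * t + s * (t * (s - 1))" by simp
  also have "\<dots> = s\<^sup>2 * t" using s_gt by (cases s) (auto simp: power2_eq_square algebra_simps)
  finally show ?thesis .
qed

text \<open>With N the sum of all \<open>A j\<close>, this is the coefficient at \<open>x\<close> of
  \<open>A i\<close> N = (s + t) \<open>A i\<close> + G - \<open>B i\<close> in the group algebra.
  The index \<open>i\<close> contributes s \<open>A i\<close>; another index has only the
  factorisation \<open>u = x\<close> if \<open>x\<close> is in \<open>B i\<close>, and outside
  \<open>B i\<close> exactly one factorisation occurs over all indices.\<close>

lemma card_A_A:
  assumes i: "i \<in> I" and x: "x \<in> carrier G"
  shows "(\<Sum>j\<in>I. card {u \<in> A i. inv u \<otimes> x \<in> A j}) + of_bool (x \<in> B i)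
       = (s + t) * of_bool (x \<in> A i) + 1"
proof -
  interpret Ai: subgroup "A i" G using A_sub i .
  have "(\<Sum>j\<in>I. card {u \<in> A i. inv u \<otimes> x \<in> A j})
      = card {u \<in> A i. inv u \<otimes> x \<in> A i} + (\<Sum>j\<in>I - {i}. card {u \<in> A i. inv u \<otimes> x \<in> A j})"
    using finite_I i by (simp add: sum.remove)
  also have "{u \<in> A i. inv u \<otimes> x \<in> A i} = (if x \<in> A i then A i else {})"
    using subgroup_inv_mult_mem_iff[OF A_sub[OF i] _ x] by auto
  also have "card \<dots> = s * of_bool (x \<in> A i)" using card_A[OF i] by simp
  also have "(\<Sum>j\<in>I - {i}. card {u \<in> A i. inv u \<otimes> x \<in> A j})
      = t * of_bool (x \<in> A i) + of_bool (x \<notin> B i)"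
  proof (cases "x \<in> B i")
    case True
    have "card {u \<in> A i. inv u \<otimes> x \<in> A j} = of_bool (x \<in> A i)" if j: "j \<in> I - {i}" for j
    proof -
      have iff: "inv u \<otimes> x \<in> A j \<longleftrightarrow> u = x" if u: "u \<in> A i" for u
      proof
        assume "inv u \<otimes> x \<in> A j"
        moreover have "inv u \<otimes> x \<in> B i"
          using u True A_subset_B[OF i] B_sub[OF i]
          by (meson subgroup.m_closed subgroup.m_inv_closed subsetD)
        ultimately have "inv u \<otimes> x = \<one>" using B_inter_A[OF i, of j] j by blast
        thus "u = x" using u x by (metis Ai.mem_carrier inv_cancel_left(1) r_one)
      next
        assume "u = x"
        thus "inv u \<otimes> x \<in> A j" using x j one_A by simp
      qed
      have "{u \<in> A i. inv u \<otimes> x \<in> A j} = (if x \<in> A i then {x} else {})"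
        using iff by auto
      thus ?thesis by simp
    qed
    thus ?thesis using True card_I i finite_I by simp
  next
    case False
    hence "card {(j, a). j \<in> I - {i} \<and> a \<in> A i \<and> inv a \<otimes> x \<in> A j} = 1"
      using factor[OF i x] by (simp add: B_def)
    also have "{(j, a). j \<in> I - {i} \<and> a \<in> A i \<and> inv a \<otimes> x \<in> A j}
        = Sigma (I - {i}) (\<lambda>j. {u \<in> A i. inv u \<otimes> x \<in> A j})" by auto
    finally have "(\<Sum>j\<in>I - {i}. card {u \<in> A i. inv u \<otimes> x \<in> A j}) = 1"
      using finite_I finite_A[OF i] by simp
    moreover have "x \<notin> A i" using False A_subset_B[OF i] by blast
    ultimately show ?thesis using False by simp
  qed
  finally show ?thesis by (simp add: algebra_simps)
qed

text \<open>For \<open>j \<noteq> i\<close> the subgroups \<open>A i\<close> and \<open>B j\<close>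
  are complements, so each such index contributes one factorisation of every
  \<open>x\<close>.\<close>

lemma card_A_B:
  assumes i: "i \<in> I" and x: "x \<in> carrier G"
  shows "(\<Sum>j\<in>I. card {u \<in> A i. inv u \<otimes> x \<in> B j}) = s * of_bool (x \<in> B i) + t"
proof -
  have "(\<Sum>j\<in>I. card {u \<in> A i. inv u \<otimes> x \<in> B j})
      = card {u \<in> A i. inv u \<otimes> x \<in> B i} + (\<Sum>j\<in>I - {i}. card {u \<in> A i. inv u \<otimes> x \<in> B j})"
    using finite_I i by (simp add: sum.remove)
  also have "{u \<in> A i. inv u \<otimes> x \<in> B i} = (if x \<in> B i then A i else {})"
    using subgroup_inv_mult_mem_iff[OF B_sub[OF i] _ x] A_subset_B[OF i] by auto
  also have "card \<dots> = s * of_bool (x \<in> B i)" using card_A[OF i] by simp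
  also have "(\<Sum>j\<in>I - {i}. card {u \<in> A i. inv u \<otimes> x \<in> B j}) = (\<Sum>j\<in>I - {i}. 1)"
  proof (rule sum.cong)
    fix j assume j: "j \<in> I - {i}"
    hence int: "A i \<inter> B j = {\<one>}" using B_inter_A[of j i] i by blast
    show "card {u \<in> A i. inv u \<otimes> x \<in> B j} = 1"
      using card_factorizations_subgroups[OF fin A_sub[OF i] B_sub _ x, of j] j
      by (simp add: int card_A[OF i] card_B card_G power2_eq_square)
  qed simp
  also have "\<dots> = t" using card_I i finite_I by simp
  finally show ?thesis .
qed

text \<open>The complements appear here in the opposite order; the index \<open>i\<close>
  contributes only inside \<open>B i\<close>, where \<open>A i\<close> is absorbed \<open>s\<close>
  times.\<close>

lemma card_B_A:
  assumes i: "i \<in> I" and x: "x \<in> carrier G"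
  shows "(\<Sum>j\<in>I. card {u \<in> B i. inv u \<otimes> x \<in> A j}) = s * of_bool (x \<in> B i) + t"
proof -
  have "(\<Sum>j\<in>I. card {u \<in> B i. inv u \<otimes> x \<in> A j})
      = card {u \<in> B i. inv u \<otimes> x \<in> A i} + (\<Sum>j\<in>I - {i}. card {u \<in> B i. inv u \<otimes> x \<in> A j})"
    using finite_I i by (simp add: sum.remove)
  also have "card {u \<in> B i. inv u \<otimes> x \<in> A i} = s * of_bool (x \<in> B i)"
  proof (cases "x \<in> B i")
    case True
    interpret Ai: subgroup "A i" G using A_sub i .
    interpret Bi: subgroup "B i" G using B_sub i .
    have "card {u \<in> B i. inv u \<otimes> x \<in> A i} = card (A i)"
      by (rule bij_betw_same_card[OF bij_betw_byWitness[where f = "\<lambda>u. inv u \<otimes> x"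
              and f' = "\<lambda>a. x \<otimes> inv a"]])
        (use True A_subset_B[OF i] x in \<open>auto simp: inv_mult_group m_assoc\<close>)
    thus ?thesis using True card_A[OF i] by simp
  next
    case False
    have "inv u \<otimes> x \<notin> A i" if "u \<in> B i" for u
      using that False subgroup_inv_mult_mem_iff[OF B_sub[OF i] that x] A_subset_B[OF i] by blast
    hence "{u \<in> B i. inv u \<otimes> x \<in> A i} = {}" by blast
    thus ?thesis using False by (simp only: card.empty) simp
  qed
  also have "(\<Sum>j\<in>I - {i}. card {u \<in> B i. inv u \<otimes> x \<in> A j}) = (\<Sum>j\<in>I - {i}. 1)"
  proof (rule sum.cong)
    fix j assume j: "j \<in> I - {i}"
    have "B i \<inter> A j = {\<one>}" using B_inter_A[OF i, of j] j by blast
    thus "card {u \<in> B i. inv u \<otimes> x \<in> A j} = 1"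
      using card_factorizations_subgroups[OF fin B_sub[OF i] A_sub _ x, of j] j
      by (simp add: i card_A card_B card_G power2_eq_square mult_ac)
  qed simp
  also have "\<dots> = t" using card_I i finite_I by simp
  finally show ?thesis .
qed

text \<open>Distinct tangent subgroups meet in \<open>S\<close> and the product of their orders is
  \<open>t\<close> times that of \<open>G\<close>, so every \<open>x\<close> has \<open>t\<close>
  factorisations for each \<open>j \<noteq> i\<close>.\<close>

lemma card_B_B:
  assumes i: "i \<in> I" and x: "x \<in> carrier G"
  shows "(\<Sum>j\<in>I. card {u \<in> B i. inv u \<otimes> x \<in> B j}) = s * t * of_bool (x \<in> B i) + t\<^sup>2"
proof -
  have "(\<Sum>j\<in>I. card {u \<in> B i. inv u \<otimes> x \<in> B j})
      = card {u \<in> B i. inv u \<otimes> x \<in> B i} + (\<Sum>j\<in>I - {i}. card {u \<in> B i. inv u \<otimes> x \<in> B j})"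
    using finite_I i by (simp add: sum.remove)
  also have "{u \<in> B i. inv u \<otimes> x \<in> B i} = (if x \<in> B i then B i else {})"
    using subgroup_inv_mult_mem_iff[OF B_sub[OF i] _ x] by auto
  also have "card \<dots> = s * t * of_bool (x \<in> B i)" using card_B[OF i] by simp
  also have "(\<Sum>j\<in>I - {i}. card {u \<in> B i. inv u \<otimes> x \<in> B j}) = (\<Sum>j\<in>I - {i}. t)"
  proof (rule sum.cong)
    fix j assume j: "j \<in> I - {i}"
    have "B i \<inter> B j = S" using B_inter[OF i, of j] j by blast
    thus "card {u \<in> B i. inv u \<otimes> x \<in> B j} = t"
      using card_factorizations_subgroups[OF fin B_sub[OF i] B_sub _ x, of j] j
      by (simp add: i card_B card_G card_S power2_eq_square mult_ac)
  qed simp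
  also have "\<dots> = t\<^sup>2" using card_I i finite_I by (simp add: power2_eq_square)
  finally show ?thesis .
qed

end

section \<open>Indicator functions and the idempotent of the family\<close>

context group
begin

lemma conj_closed_normal:
  assumes "N \<lhd> G" "g \<in> carrier G" "x \<in> carrier G"
  shows "inv g \<otimes> x \<otimes> g \<in> N \<longleftrightarrow> x \<in> N"
proof
  assume "inv g \<otimes> x \<otimes> g \<in> N"
  hence "g \<otimes> (inv g \<otimes> x \<otimes> g) \<otimes> inv g \<in> N" using normal.inv_op_closed2[OF assms(1,2)] by blast
  thus "x \<in> N" using assms by (simp add: m_assoc)
qed (use normal.inv_op_closed1[OF assms(1,2)] in blast)

lemma convolution_indicators:
  assumes "finite (carrier G)" "V \<subseteq> carrier G"
  shows "(\<Sum>u\<in>carrier G. of_bool (u \<in> V) * of_bool (inv u \<otimes> x \<in> W))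
       = (of_nat (card {u \<in> V. inv u \<otimes> x \<in> W}) :: complex)"
proof -
  have "(\<Sum>u\<in>carrier G. of_bool (u \<in> V) * of_bool (inv u \<otimes> x \<in> W))
      = (\<Sum>u\<in>carrier G. of_bool (u \<in> {u \<in> V. inv u \<otimes> x \<in> W}) :: complex)"
    by (intro sum.cong) auto
  also have "\<dots> = of_nat (card (carrier G \<inter> {u \<in> V. inv u \<otimes> x \<in> W}))"
    using assms(1) by (simp only: sum_of_bool_eq Int_def mem_Collect_eq)
  also have "carrier G \<inter> {u \<in> V. inv u \<otimes> x \<in> W} = {u \<in> V. inv u \<otimes> x \<in> W}"
    using assms(2) by blast
  finally show ?thesis .
qed

end

context kantor_family
begin

text \<open>This is \<open>\<Sum>\<^sub>i A\<^sub>i (1 - S/t)\<close> in the group algebra, normalised to an idempotent.\<close>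

definition idem :: "'a \<Rightarrow> complex" where
  "idem x = ((\<Sum>i\<in>I. of_bool (x \<in> A i)) - (\<Sum>i\<in>I. of_bool (x \<in> B i)) / of_nat t) / of_nat (s + t)"

text \<open>Let N and N' be the sums of the \<open>A i\<close> and of the \<open>B i\<close>. The
  four counts give N N = (s + t) N + (t + 1) G - N', N N' = N' N = s N' + t (t + 1) G and N' N' = s
  t N' + t^2 (t + 1) G. They are inserted into the square of N - N'/t.\<close>

lemma idem_convolution:
  assumes x: "x \<in> carrier G"
  shows "(\<Sum>u\<in>carrier G. idem u * idem (inv u \<otimes> x)) = idem x"
proof -
  define f :: "('i \<Rightarrow> 'a set) \<Rightarrow> 'a \<Rightarrow> complex"
    where "f V u = (\<Sum>i\<in>I. of_bool (u \<in> V i))" for V u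
  have idem: "idem u = (f A u - f B u / of_nat t) / of_nat (s + t)" for u
    by (simp add: idem_def f_def)
  have conv: "(\<Sum>u\<in>carrier G. f V u * f W (inv u \<otimes> x))
      = (\<Sum>i\<in>I. of_nat (\<Sum>j\<in>I. card {u \<in> V i. inv u \<otimes> x \<in> W j}))"
    if V: "\<And>i. i \<in> I \<Longrightarrow> V i \<subseteq> carrier G" for V W
  proof -
    have "(\<Sum>u\<in>carrier G. f V u * f W (inv u \<otimes> x))
        = (\<Sum>u\<in>carrier G. \<Sum>i\<in>I. \<Sum>j\<in>I. of_bool (u \<in> V i) * of_bool (inv u \<otimes> x \<in> W j))"
      by (simp only: f_def sum_product)
    also have "\<dots> = (\<Sum>i\<in>I. \<Sum>u\<in>carrier G. \<Sum>j\<in>I. of_bool (u \<in> V i) * of_bool (inv u \<otimes> x \<in> W j))"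
      by (rule sum.swap)
    also have "\<dots> = (\<Sum>i\<in>I. \<Sum>j\<in>I. \<Sum>u\<in>carrier G. of_bool (u \<in> V i) * of_bool (inv u \<otimes> x \<in> W j))"
      by (intro sum.cong refl sum.swap)
    also have "\<dots> = (\<Sum>i\<in>I. of_nat (\<Sum>j\<in>I. card {u \<in> V i. inv u \<otimes> x \<in> W j}))"
      unfolding of_nat_sum by (intro sum.cong refl convolution_indicators fin V)
    finally show ?thesis .
  qed
  have convA: "(\<Sum>u\<in>carrier G. f A u * f W (inv u \<otimes> x))
      = (\<Sum>i\<in>I. of_nat (\<Sum>j\<in>I. card {u \<in> A i. inv u \<otimes> x \<in> W j}))" for W
    by (rule conv) (rule A_carrier)
  have convB: "(\<Sum>u\<in>carrier G. f B u * f W (inv u \<otimes> x))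
      = (\<Sum>i\<in>I. of_nat (\<Sum>j\<in>I. card {u \<in> B i. inv u \<otimes> x \<in> W j}))" for W
    by (rule conv) (rule B_carrier)
  have AA: "(\<Sum>u\<in>carrier G. f A u * f A (inv u \<otimes> x)) = of_nat (s + t) * f A x + of_nat (t + 1) - f B x"
  proof -
    have "of_nat (\<Sum>j\<in>I. card {u \<in> A i. inv u \<otimes> x \<in> A j})
        = of_nat (s + t) * of_bool (x \<in> A i) + 1 - (of_bool (x \<in> B i) :: complex)" if "i \<in> I" for i
      using arg_cong[OF card_A_A[OF that x], of "of_nat :: nat \<Rightarrow> complex"]
      by (simp only: of_nat_add of_nat_mult of_nat_of_bool of_nat_1 eq_diff_eq)
    hence "(\<Sum>i\<in>I. of_nat (\<Sum>j\<in>I. card {u \<in> A i. inv u \<otimes> x \<in> A j}))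
        = (\<Sum>i\<in>I. of_nat (s + t) * of_bool (x \<in> A i) + 1 - (of_bool (x \<in> B i) :: complex))"
      by (rule sum.cong[OF refl])
    thus ?thesis using card_I unfolding convA
      by (simp only: f_def sum.distrib sum_subtractf sum_distrib_left sum_constant
          mult_1_right)
  qed
  have of_nat_eq: "(\<Sum>i\<in>I. of_nat (\<Sum>j\<in>I. card {u \<in> V i. inv u \<otimes> x \<in> W j}))
      = of_nat c * f B x + of_nat d * of_nat (t + 1)"
    if VW: "\<And>i. i \<in> I \<Longrightarrow> (\<Sum>j\<in>I. card {u \<in> V i. inv u \<otimes> x \<in> W j}) = c * of_bool (x \<in> B i) + d"
    for V W :: "'i \<Rightarrow> 'a set" and c d
  proof -
    have "of_nat (\<Sum>j\<in>I. card {u \<in> V i. inv u \<otimes> x \<in> W j})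
        = of_nat c * of_bool (x \<in> B i) + (of_nat d :: complex)" if "i \<in> I" for i
      unfolding VW[OF that] by (simp only: of_nat_add of_nat_mult of_nat_of_bool)
    hence "(\<Sum>i\<in>I. of_nat (\<Sum>j\<in>I. card {u \<in> V i. inv u \<otimes> x \<in> W j}))
        = (\<Sum>i\<in>I. of_nat c * of_bool (x \<in> B i) + (of_nat d :: complex))"
      by (rule sum.cong[OF refl])
    thus ?thesis using card_I
      by (simp only: f_def sum.distrib sum_distrib_left sum_constant mult.commute)
  qed
  have AB: "(\<Sum>u\<in>carrier G. f A u * f B (inv u \<otimes> x)) = of_nat s * f B x + of_nat t * of_nat (t + 1)"
    unfolding convA by (rule of_nat_eq) (rule card_A_B[OF _ x])
  have BA: "(\<Sum>u\<in>carrier G. f B u * f A (inv u \<otimes> x)) = of_nat s * f B x + of_nat t * of_nat (t + 1)"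
    unfolding convB by (rule of_nat_eq) (rule card_B_A[OF _ x])
  have BB: "(\<Sum>u\<in>carrier G. f B u * f B (inv u \<otimes> x))
      = of_nat (s * t) * f B x + of_nat (t\<^sup>2) * of_nat (t + 1)"
    unfolding convB by (rule of_nat_eq) (rule card_B_B[OF _ x])
  define p q where "p = (of_nat s :: complex)" and "q = (of_nat t :: complex)"
  have nz: "q \<noteq> 0" "p + q \<noteq> 0"
    using s_gt t_gt by (simp_all add: p_def q_def flip: of_nat_add)
  have "(\<Sum>u\<in>carrier G. idem u * idem (inv u \<otimes> x))
      = (\<Sum>u\<in>carrier G. (f A u * f A (inv u \<otimes> x) - f A u * f B (inv u \<otimes> x) / q
          - f B u * f A (inv u \<otimes> x) / q + f B u * f B (inv u \<otimes> x) / q\<^sup>2) / (p + q)\<^sup>2)"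
    unfolding idem p_def[symmetric] q_def[symmetric] of_nat_add
    using nz by (intro sum.cong refl) (simp add: field_simps power2_eq_square)
  also have "\<dots> = ((p + q) * f A x + (q + 1) - f B x - (p * f B x + q * (q + 1)) / q
          - (p * f B x + q * (q + 1)) / q + (p * q * f B x + q\<^sup>2 * (q + 1)) / q\<^sup>2) / (p + q)\<^sup>2"
    unfolding sum_divide_distrib[symmetric] sum.distrib sum_subtractf AA AB BA BB
    by (simp add: p_def q_def add.commute)
  \<comment> \<open>The multiples of \<open>q + 1\<close> cancel, and the coefficient of
    \<open>f B x\<close> collects to -(p + q)/q.\<close>
  also have "(p + q) * f A x + (q + 1) - f B x - (p * f B x + q * (q + 1)) / q
          - (p * f B x + q * (q + 1)) / q + (p * q * f B x + q\<^sup>2 * (q + 1)) / q\<^sup>2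
      = (p + q) * (f A x - f B x / q)"
    using nz(1) by (simp add: field_simps power2_eq_square)
  also have "(p + q) * (f A x - f B x / q) / (p + q)\<^sup>2 = (f A x - f B x / q) / (p + q)"
    using nz(2) by (simp add: power2_eq_square)
  finally show ?thesis by (simp add: idem p_def q_def)
qed

section \<open>Factorisation of the group, and normality for equal parameters\<close>

lemma A_B_product:
  assumes "i \<in> I" "j \<in> I" "i \<noteq> j" and x: "x \<in> carrier G"
  obtains a b where "a \<in> A i" "b \<in> B j" "x = a \<otimes> b"
proof -
  have "A i \<inter> B j = {\<one>}" using B_inter_A[of j i] assms by blast
  hence "card {u \<in> A i. inv u \<otimes> x \<in> B j} = 1"
    using card_factorizations_subgroups[OF fin A_sub[OF assms(1)] B_sub[OF assms(2)] _ x] assms(1,2)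
    by (simp add: card_A card_B card_G power2_eq_square)
  then obtain u where "{u \<in> A i. inv u \<otimes> x \<in> B j} = {u}" by (rule card_1_singletonE)
  hence u: "u \<in> A i" "inv u \<otimes> x \<in> B j" by blast+
  moreover have "u \<in> carrier G" using u(1) A_carrier assms(1) by blast
  hence "x = u \<otimes> (inv u \<otimes> x)" using x by simp
  ultimately show ?thesis using that by blast
qed

text \<open>If \<open>s = t\<close>, the \<open>B\<^sub>i/S\<close> partition \<open>G/S\<close>.\<close>

lemma B_normal_if_eq:
  assumes st: "s = t" and i: "i \<in> I"
  shows "B i \<lhd> G"
proof -
  have S: "S \<subseteq> carrier G" "finite S" using S_carrier fin finite_subset by blast+
  have "card (\<Union>j\<in>I. B j - S) = (\<Sum>j\<in>I. card (B j - S))"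
  proof (rule card_UN_disjoint)
    show "\<forall>j\<in>I. \<forall>k\<in>I. j \<noteq> k \<longrightarrow> (B j - S) \<inter> (B k - S) = {}" using B_inter by blast
  qed (use finite_I finite_B in auto)
  also have "\<dots> = (\<Sum>j\<in>I. s * t - t)"
    by (intro sum.cong refl) (simp add: card_Diff_subset[OF S(2)] S_subset_B card_B card_S)
  finally have U: "card (\<Union>j\<in>I. B j - S) = (t + 1) * (s * t - t)" using card_I by simp
  \<comment> \<open>For \<open>s = t\<close> the size (t + 1)(t^2 - t) + t is t^3, the order of the
    group, so the \<open>B j\<close> cover everything.\<close>
  have "card ((\<Union>j\<in>I. B j - S) \<union> S) = card (\<Union>j\<in>I. B j - S) + card S"
    using finite_I finite_B S(2) by (intro card_Un_disjoint) auto
  also have "\<dots> = (t + 1) * (s * t - t) + t" by (simp only: U card_S)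
  also have "\<dots> = card (carrier G)"
    using t_gt unfolding card_G st by (cases t) (auto simp: power2_eq_square algebra_simps)
  finally have "(\<Union>j\<in>I. B j - S) \<union> S = carrier G"
    using B_carrier S(1) by (intro card_subset_eq[OF fin]) auto
  hence cover: "\<exists>j\<in>I. x \<in> B j" if "x \<in> carrier G" for x
    using that S_subset_B[OF i] i by blast
  have "x \<otimes> h \<otimes> inv x \<in> B i" if x: "x \<in> carrier G" and h: "h \<in> B i" for x h
  proof (rule ccontr)
    assume n: "x \<otimes> h \<otimes> inv x \<notin> B i"
    have hc: "h \<in> carrier G" using h B_carrier i by blast
    have "x \<otimes> h \<otimes> inv x \<in> carrier G" using x hc by simp
    then obtain j where j: "j \<in> I" "x \<otimes> h \<otimes> inv x \<in> B j" using cover by blast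
    hence "j \<noteq> i" using n by blast
    \<comment> \<open>Conjugation by \<open>b\<close> preserves \<open>B j\<close> and conjugation
      by \<open>a\<close> preserves \<open>B i\<close>. Splitting \<open>x\<close> in this order
      therefore places the conjugate of \<open>h\<close> by \<open>a\<close> in both, hence in
      \<open>S\<close>.\<close>
    then obtain b a where ba: "b \<in> A j" "a \<in> B i" "x = b \<otimes> a"
      using A_B_product[OF j(1) i _ x] by blast
    interpret Bi: subgroup "B i" G using B_sub i .
    interpret Bj: subgroup "B j" G using B_sub j(1) .
    have b: "b \<in> B j" using ba A_subset_B j by blast
    have "inv b \<otimes> (x \<otimes> h \<otimes> inv x) \<otimes> b \<in> B j"
      by (rule Bj.m_closed[OF Bj.m_closed[OF Bj.m_inv_closed[OF b] j(2)] b])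
    also have "inv b \<otimes> (x \<otimes> h \<otimes> inv x) \<otimes> b = a \<otimes> h \<otimes> inv a"
      using b ba(2) h by (simp add: ba(3) inv_mult_group m_assoc)
    finally have "a \<otimes> h \<otimes> inv a \<in> B j" .
    moreover have "a \<otimes> h \<otimes> inv a \<in> B i"
      by (rule Bi.m_closed[OF Bi.m_closed[OF ba(2) h] Bi.m_inv_closed[OF ba(2)]])
    ultimately have "a \<otimes> h \<otimes> inv a \<in> S" using B_inter[OF i j(1)] \<open>j \<noteq> i\<close> by blast
    hence "inv a \<otimes> (a \<otimes> h \<otimes> inv a) \<otimes> a \<in> S"
      using normal.inv_op_closed1[OF S_normal, of a] ba(2) by simp
    also have "inv a \<otimes> (a \<otimes> h \<otimes> inv a) \<otimes> a = h" using ba(2) h by (simp add: m_assoc)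
    finally have "x \<otimes> h \<otimes> inv x \<in> S" using normal.inv_op_closed2[OF S_normal x] by blast
    thus False using n S_subset_B[OF i] by blast
  qed
  thus ?thesis using B_sub[OF i] by (simp add: normal_inv_iff)
qed

end

section \<open>Normal tangent subgroups: conjugacy and commutators\<close>

locale normal_kantor_family = kantor_family +
  assumes B_normal: "i \<in> I \<Longrightarrow> B i \<lhd> G"
begin

text \<open>Otherwise, by normality, every conjugate of \<open>K\<close> lies in \<open>B i\<close>
  and outside \<open>S\<close>, hence in no \<open>A j\<close> and in no other \<open>B j\<close>.
  Then \<open>idem\<close> is constant on the conjugacy class, and the trace - s^2/(s + t) would
  have to be an integer.\<close>

lemma conj_mem_A:
  assumes nd: "\<not> s + t dvd s\<^sup>2" and i: "i \<in> I" and K: "K \<in> B i" "K \<notin> S"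
  shows "\<exists>g\<in>carrier G. inv g \<otimes> K \<otimes> g \<in> A i"
proof (rule ccontr)
  assume neg: "\<not> ?thesis"
  have KG: "K \<in> carrier G" using K B_carrier i by blast
  have val: "idem (inv g \<otimes> K \<otimes> g) = - 1 / (of_nat t * of_nat (s + t))" if g: "g \<in> carrier G" for g
  proof -
    let ?k = "inv g \<otimes> K \<otimes> g"
    have kB: "?k \<in> B i" using conj_closed_normal[OF B_normal[OF i] g KG] K by blast
    have kS: "?k \<notin> S" using conj_closed_normal[OF S_normal g KG] K by blast
    have "?k \<notin> A j" if j: "j \<in> I" for j
    proof (cases "j = i")
      case True thus ?thesis using neg g by blast
    next
      case False
      show ?thesis
      proof
        assume "?k \<in> A j"
        hence "?k = \<one>" using B_inter_A[OF i j not_sym[OF False]] kB by blast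
        thus False using kS one_S by simp
      qed
    qed
    hence "(\<Sum>j\<in>I. of_bool (?k \<in> A j)) = (\<Sum>j\<in>I. 0 :: complex)" by (intro sum.cong) auto
    moreover have "(?k \<in> B j) = (j = i)" if "j \<in> I" for j
      using B_inter[OF i that] kB kS by blast
    hence "(\<Sum>j\<in>I. of_bool (?k \<in> B j)) = (\<Sum>j\<in>I. of_bool (j = i) :: complex)"
      by (intro sum.cong) auto
    moreover have "(\<Sum>j\<in>I. of_bool (j = i) :: complex) = 1"
      using finite_I i by (simp add: of_bool_def)
    ultimately show ?thesis by (simp add: idem_def)
  qed
  have nz: "(of_nat t :: complex) \<noteq> 0" "(of_nat (s + t) :: complex) \<noteq> 0"
    using t_gt by (simp_all del: of_nat_add)
  have "(\<Sum>g\<in>carrier G. idem (inv g \<otimes> K \<otimes> g)) = of_nat (s\<^sup>2 * t) * (- 1 / (of_nat t * of_nat (s + t)))"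
    using val by (simp add: card_G)
  also have "\<dots> = - (of_nat (s\<^sup>2) / of_nat (s + t))"
    using nz by (simp add: field_simps del: of_nat_add)
  finally have sum: "(\<Sum>g\<in>carrier G. idem (inv g \<otimes> K \<otimes> g)) = - (of_nat (s\<^sup>2) / of_nat (s + t))" .
  have "- (of_nat (s\<^sup>2) / of_nat (s + t)) \<in> (\<int> :: complex set)"
    using trace_translated_idempotent_integer[OF fin KG idem_convolution] unfolding sum
    by (simp del: of_nat_add of_nat_power)
  then obtain m :: int where "- (of_nat (s\<^sup>2) / of_nat (s + t)) = (of_int m :: complex)"
    by (elim Ints_cases)
  hence "(of_nat (s\<^sup>2) :: complex) = of_int (- m) * of_nat (s + t)"
    using nz by (simp add: field_simps del: of_nat_add of_nat_power) (metis add.inverse_inverse mult_minus_left)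
  hence "(of_int (int (s\<^sup>2)) :: complex) = of_int (- m * int (s + t))" by simp
  hence "int (s\<^sup>2) = - m * int (s + t)" by (simp only: of_int_eq_iff)
  hence "int (s + t) dvd int (s\<^sup>2)" by simp
  thus False using nd by (simp only: int_dvd_int_iff)
qed

text \<open>The commutator of elements of two distinct tangent subgroups lies in both, as they are
  normal, and so in \<open>S\<close>. Any \<open>g\<close> is a product of elements of
  \<open>B j\<close> and \<open>B k\<close> with \<open>i\<close>, \<open>j\<close>,
  \<open>k\<close> distinct, so \<open>B i\<close> is central modulo \<open>S\<close>.\<close>

lemma conj_mod_S:
  assumes i: "i \<in> I" and x: "x \<in> B i" and g: "g \<in> carrier G"
  shows "inv x \<otimes> (inv g \<otimes> x \<otimes> g) \<in> S"
proof -
  have other: "inv y \<otimes> (inv b \<otimes> y \<otimes> b) \<in> S" if "j \<in> I" "j \<noteq> i" "y \<in> B i" "b \<in> B j" for y b j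
  proof -
    interpret Bi: subgroup "B i" G using B_sub i .
    interpret Bj: subgroup "B j" G using B_sub[OF that(1)] .
    have "inv b \<otimes> y \<otimes> b \<in> B i"
      using conj_closed_normal[OF B_normal[OF i]] that by simp
    hence "inv y \<otimes> (inv b \<otimes> y \<otimes> b) \<in> B i" using that by blast
    moreover have "inv y \<otimes> inv b \<otimes> y \<in> B j"
      using conj_closed_normal[OF B_normal[OF that(1)]] that by simp
    hence "inv y \<otimes> inv b \<otimes> y \<otimes> b \<in> B j" using that by blast
    hence "inv y \<otimes> (inv b \<otimes> y \<otimes> b) \<in> B j" using that by (simp add: m_assoc)
    ultimately show ?thesis using B_inter[OF i that(1)] that(2) by blast
  qed
  obtain j where j: "j \<in> I" "j \<noteq> i" using third_index[OF i i] by blast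
  obtain k where k: "k \<in> I" "k \<noteq> i" "k \<noteq> j" using third_index[OF i j(1)] by blast
  obtain b c where bc: "b \<in> A j" "c \<in> B k" "g = b \<otimes> c"
    using A_B_product[OF j(1) k(1) _ g] k(3) by blast
  have b: "b \<in> B j" using bc A_subset_B j by blast
  interpret Bi: subgroup "B i" G using B_sub i .
  interpret Bj: subgroup "B j" G using B_sub j(1) .
  interpret Bk: subgroup "B k" G using B_sub k(1) .
  interpret S: subgroup S G using S_sub .
  let ?y = "inv b \<otimes> x \<otimes> b"
  have y: "?y \<in> B i" using conj_closed_normal[OF B_normal[OF i]] x b by simp
  \<comment> \<open>Conjugating first by \<open>b\<close>, then by \<open>c\<close>, changes the
    element by a factor in \<open>S\<close> each time; the product telescopes.\<close>
  have "(inv x \<otimes> ?y) \<otimes> (inv ?y \<otimes> (inv c \<otimes> ?y \<otimes> c)) \<in> S"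
    by (rule S.m_closed[OF other[OF j x b] other[OF k(1,2) y bc(2)]])
  also have "(inv x \<otimes> ?y) \<otimes> (inv ?y \<otimes> (inv c \<otimes> ?y \<otimes> c)) = inv x \<otimes> (inv g \<otimes> x \<otimes> g)"
    using x b bc(2) y by (simp add: bc(3) inv_mult_group m_assoc)
  finally show ?thesis .
qed

text \<open>Commutators within \<open>A i\<close> lie in \<open>S\<close>, which meets
  \<open>A i\<close> trivially.\<close>

lemma A_comm:
  assumes i: "i \<in> I" and ab: "a \<in> A i" "b \<in> A i"
  shows "a \<otimes> b = b \<otimes> a"
proof -
  interpret Ai: subgroup "A i" G using A_sub i .
  have B: "a \<in> B i" using ab(1) A_subset_B[OF i] by blast
  have "inv a \<otimes> (inv b \<otimes> a \<otimes> b) \<in> S"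
    using conj_mod_S[OF i B] ab(2) by simp
  moreover have "inv a \<otimes> (inv b \<otimes> a \<otimes> b) \<in> A i" using ab by blast
  ultimately have "inv a \<otimes> (inv b \<otimes> a \<otimes> b) = \<one>" using A_S[OF i] by blast
  moreover have "b \<otimes> (a \<otimes> (inv a \<otimes> (inv b \<otimes> a \<otimes> b))) = a \<otimes> b"
    using ab by (simp add: m_assoc)
  ultimately show ?thesis using ab by simp
qed

end

section \<open>Supplements of \<open>S\<close>\<close>

context group
begin

text \<open>A prime divisor of \<open>n\<close> is the order of some subgroup, by Sylow's theorem
  with exponent 1, and that prime already kills the elements of this subgroup.\<close>

lemma cauchy_torsion:
  assumes fin: "finite (carrier G)" and n: "n dvd card (carrier G)" "n > 1"
  obtains a where "a \<in> carrier G" "a \<noteq> \<one>" "a [^] n = \<one>"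
proof -
  obtain p where p: "Factorial_Ring.prime p" "p dvd n" using prime_factor_nat[of n] n(2) by auto
  hence "p dvd card (carrier G)" using n(1) dvd_trans by blast
  then obtain m where "Coset.order G = p ^ 1 * m" by (auto simp: Coset.order_def elim: dvdE)
  then obtain H where H: "subgroup H G" "card H = p"
    using sylow_thm[OF p(1) is_group _ fin, of 1 m] by auto
  interpret H: group "G\<lparr>carrier := H\<rparr>" using subgroup.subgroup_is_group[OF H(1) is_group] .
  have "card H > 1" using H(2) prime_gt_1_nat[OF p(1)] by simp
  hence "\<not> H \<subseteq> {\<one>}" using card_mono[of "{\<one>}" H] by auto
  then obtain a where a: "a \<in> H" "a \<noteq> \<one>" by blast
  have aG: "a \<in> carrier G" using a H(1) subgroup.subset by blast
  have "a [^]\<^bsub>G\<lparr>carrier := H\<rparr>\<^esub> p = \<one>"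
    using H.pow_order_eq_1[of a] a(1) H(2) by (simp add: Coset.order_def)
  hence "a [^] p = \<one>" by (simp add: nat_pow_consistent[symmetric])
  moreover obtain k where "n = p * k" using p(2) by (elim dvdE)
  ultimately have "a [^] n = \<one>" using aG by (metis nat_pow_one nat_pow_pow)
  thus ?thesis using that a aG by blast
qed

text \<open>Powers may be computed modulo \<open>N\<close>. This carries torsion along the
  projection whose kernel is a normal complement.\<close>

lemma pow_mult_normal:
  assumes N: "N \<lhd> G" and b: "b \<in> carrier G" and c: "c \<in> N"
  shows "\<exists>d\<in>N. (b \<otimes> c) [^] (n::nat) = b [^] n \<otimes> d"
proof (induction n)
  case 0
  have "\<one> \<in> N" using N normal_imp_subgroup subgroup.one_closed by blast
  thus ?case by (intro bexI[of _ \<one>]) simp_all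
next
  case (Suc n)
  interpret N: subgroup N G using N normal_imp_subgroup by blast
  obtain d where d: "d \<in> N" "(b \<otimes> c) [^] n = b [^] n \<otimes> d" using Suc by blast
  have "inv b \<otimes> d \<otimes> b \<otimes> c \<in> N"
    using normal.inv_op_closed1[OF N b d(1)] c by (rule N.m_closed)
  moreover have "(b \<otimes> c) [^] Suc n = b [^] Suc n \<otimes> (inv b \<otimes> d \<otimes> b \<otimes> c)"
    using b c d by (simp add: m_assoc)
  ultimately show ?case by blast
qed

end

text \<open>If the order of the torsion subgroup shared a divisor with \<open>m\<close>, it would
  contain a nontrivial element killed by two coprime numbers. So this order is prime to
  \<open>m\<close>, and Lagrange makes it a divisor of \<open>n\<close>.\<close>

lemma (in comm_group) card_torsion_le:
  assumes fin: "finite (carrier G)" and nm: "card (carrier G) = n * m" "coprime n m"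
  shows "card {a \<in> carrier G. a [^] n = \<one>} \<le> n"
proof -
  let ?U = "{a \<in> carrier G. a [^] n = \<one>}"
  have U: "subgroup ?U G"
    by (rule subgroupI) (auto simp: nat_pow_distrib nat_pow_inv)
  interpret U: group "G\<lparr>carrier := ?U\<rparr>" using subgroup.subgroup_is_group[OF U is_group] .
  have n0: "n > 0" using nm(1) fin by (metis card_gt_0_iff mult_is_0 not_gr_zero one_closed empty_iff)
  have "coprime (card ?U) m"
  proof (rule ccontr)
    assume "\<not> coprime (card ?U) m"
    define q where "q = gcd (card ?U) m"
    have q: "q dvd card ?U" "q dvd m" by (simp_all add: q_def)
    have "\<one> \<in> ?U" by simp
    hence "card ?U > 0" using fin by (subst card_gt_0_iff) auto
    hence "q > 0" by (simp add: q_def)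
    moreover have "q \<noteq> 1"
      using \<open>\<not> coprime (card ?U) m\<close> by (metis q_def coprime_iff_gcd_eq_1)
    ultimately have "q > 1" by simp
    then obtain a where a: "a \<in> ?U" "a \<noteq> \<one>" "a [^]\<^bsub>G\<lparr>carrier := ?U\<rparr>\<^esub> q = \<one>"
      using U.cauchy_torsion[of q] fin q(1) by auto
    hence "a [^] q = \<one>" by (simp add: nat_pow_consistent[symmetric])
    hence "ord a dvd q" "ord a dvd n" using a(1) by (auto simp: pow_eq_id)
    moreover have "coprime q n" using nm(2) q(2) by (meson coprime_commute coprime_divisors dvd_refl)
    ultimately have "ord a = 1" by (metis coprime_common_divisor_nat)
    thus False using a ord_eq_1 by blast
  qed
  moreover have "card ?U dvd n * m"
    unfolding nm(1)[symmetric] lagrange[OF U, unfolded Coset.order_def, symmetric] by simp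
  ultimately have "card ?U dvd n" by (simp add: coprime_dvd_mult_left_iff)
  thus ?thesis using n0 by (rule dvd_imp_le)
qed

text \<open>Divisibility forces a prime \<open>p\<close> dividing s + t over the gcd to have its
  full power in \<open>s\<close> divide \<open>t\<close>. The hypothesis \<open>bound\<close> then
  identifies \<open>t\<close> with this power, and applied to the cofactor it gives a
  contradiction.\<close>

lemma sum_not_dvd_square:
  fixes s t :: nat
  assumes ts: "1 < t" "t < s"
    and bound: "\<And>n m. s = n * m \<Longrightarrow> coprime n m \<Longrightarrow> n > 1 \<Longrightarrow> t \<le> n"
  shows "\<not> s + t dvd s\<^sup>2"
proof
  assume dvd: "s + t dvd s\<^sup>2"
  define g where "g = gcd s t"
  have g0: "g > 0" using ts by (simp add: g_def)
  obtain a b where ab: "s = a * g" "t = b * g" "coprime a b"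
    using gcd_coprime_exists[of s t] ts unfolding g_def by auto
  have a0: "a > 0" and b0: "b > 0" using ab ts by (auto intro: gr0I)
  have "g * (a + b) dvd g * (a\<^sup>2 * g)"
    using dvd unfolding ab(1,2) by (simp add: power2_eq_square algebra_simps)
  hence "a + b dvd a\<^sup>2 * g" using g0 by simp
  moreover have "gcd (b + a) a = gcd b a" by simp
  hence cop: "coprime (a + b) a"
    using ab(3) by (simp only: coprime_iff_gcd_eq_1 gcd.commute add.commute)
  ultimately have abg: "a + b dvd g"
    by (metis coprime_dvd_mult_right_iff coprime_power_right_iff)
  have "a + b \<noteq> 1" using a0 b0 by simp
  then obtain p where p: "Factorial_Ring.prime p" "p dvd a + b" using prime_factor_nat by blast
  have pa: "\<not> p dvd a" using cop p by (metis coprime_common_divisor_nat not_prime_1)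
  \<comment> \<open>\<open>p ^ k\<close> is the full \<open>p\<close>-part of \<open>s\<close>, so
    \<open>s\<close> splits into coprime factors to which \<open>bound\<close> applies.\<close>
  obtain k m where km: "s = p ^ k * m" "\<not> p dvd m"
  proof -
    have "s \<noteq> 0" using ts by simp
    thus ?thesis using that multiplicity_decompose'[of s p] p(1) by (metis not_prime_unit)
  qed
  have cpm: "coprime (p ^ k) m" using km(2) p(1) by (simp add: prime_imp_coprime)
  have "p dvd s" using p(2) abg ab(1) by (meson dvd_trans dvd_triv_right)
  hence k: "k > 0" using km by (intro gr0I) simp
  hence pk1: "p ^ k > 1" using one_less_power[OF prime_gt_1_nat[OF p(1)]] by blast
  have "coprime (p ^ k) a" using pa p(1) by (simp add: prime_imp_coprime)
  moreover have "p ^ k dvd a * g" using km(1) ab(1) by (metis dvd_triv_left)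
  ultimately have "p ^ k dvd g" by (simp add: coprime_dvd_mult_right_iff)
  hence "p ^ k dvd t" using ab(2) by simp
  hence "p ^ k \<le> t" using ts by (intro dvd_imp_le) auto
  moreover have "t \<le> p ^ k" using bound[OF km(1) cpm pk1] .
  ultimately have tp: "t = p ^ k" by simp
  have s: "s = t * m" using km tp by simp
  have m1: "m > 1" using s ts by (metis One_nat_def less_one linorder_neqE_nat mult.right_neutral
        mult_0_right not_less_zero nat_less_le)
  \<comment> \<open>The cofactor \<open>m\<close> is a coprime factor as well, so
    \<open>bound\<close> also limits it from below; the divisibility then yields
    \<open>m + 1 \<le> t\<close>.\<close>
  have tm: "t \<le> m" using bound[of m "p ^ k"] km(1) cpm m1 by (simp add: mult.commute coprime_commute)
  have "t * (m + 1) dvd t * (t * m\<^sup>2)"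
    using dvd unfolding s by (simp add: power2_eq_square algebra_simps)
  hence "m + 1 dvd t * m\<^sup>2" using ts by (subst (asm) nat_mult_dvd_cancel1) simp_all
  moreover have "coprime (m + 1) (m\<^sup>2)" by simp
  ultimately have "m + 1 dvd t" by (simp add: coprime_dvd_mult_left_iff)
  hence "m + 1 \<le> t" using ts by (intro dvd_imp_le) auto
  thus False using tm by simp
qed

section \<open>Coprime factors of \<open>s\<close> and supplements\<close>

context normal_kantor_family
begin

text \<open>A nontrivial \<open>n\<close>-torsion element of one \<open>A\<^sub>i\<close> is projected to \<open>A\<^sub>j\<close> along the various normal
  complements \<open>B\<^sub>k\<close>; the projections are distinct.\<close>

lemma t_le_coprime_factor:
  assumes s: "s = n * m" and cop: "coprime n m" and n: "n > 1"
  shows "t \<le> n"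
proof -
  obtain i j where ij: "i \<in> I" "j \<in> I" "i \<noteq> j" by (rule two_indices)
  let ?K = "I - {i, j}"
  interpret Ai: group "G\<lparr>carrier := A i\<rparr>"
    using subgroup.subgroup_is_group[OF A_sub[OF ij(1)] is_group] .
  interpret Aj: comm_group "G\<lparr>carrier := A j\<rparr>"
    using subgroup.subgroup_is_group[OF A_sub[OF ij(2)] is_group]
    by (rule group.group_comm_groupI) (use A_comm[OF ij(2)] in simp)
  obtain a where a: "a \<in> A i" "a \<noteq> \<one>" "a [^] n = \<one>"
    using Ai.cauchy_torsion[of n] n finite_A[OF ij(1)] card_A[OF ij(1)] s
    by (auto simp: nat_pow_consistent[symmetric])
  have aG: "a \<in> carrier G" using a A_carrier ij by blast
  let ?U = "{b \<in> A j. b [^] n = \<one>}"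
  have "card ?U \<le> n"
    using Aj.card_torsion_le[of n m] finite_A[OF ij(2)] card_A[OF ij(2)] s cop
    by (simp add: nat_pow_consistent[symmetric])
  moreover have "\<one> \<in> ?U" using one_A ij by simp
  \<comment> \<open>The identity is discarded because it is no projection; the \<open>t - 1\<close>
    indices in \<open>?K\<close> are compared with the remaining elements.\<close>
  ultimately have U: "card (?U - {\<one>}) \<le> n - 1" using finite_A[OF ij(2)] by simp
  \<comment> \<open>The component of \<open>a\<close> in \<open>A j\<close> modulo
    \<open>B k\<close>, which exists because \<open>A j\<close> and \<open>B k\<close> together give
    the whole group.\<close>
  define f where "f k = (SOME b. b \<in> A j \<and> inv b \<otimes> a \<in> B k)" for k
  have f: "f k \<in> A j" "inv (f k) \<otimes> a \<in> B k" if k: "k \<in> ?K" for k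
  proof -
    obtain b c where bc: "b \<in> A j" "c \<in> B k" "a = b \<otimes> c"
      using A_B_product[OF ij(2) _ _ aG, of k] k by blast
    moreover have "b \<in> carrier G" "c \<in> carrier G"
      using bc A_carrier[OF ij(2)] B_carrier[of k] k by blast+
    ultimately have "b \<in> A j \<and> inv b \<otimes> a \<in> B k" by simp
    hence "f k \<in> A j \<and> inv (f k) \<otimes> a \<in> B k" unfolding f_def by (rule someI)
    thus "f k \<in> A j" "inv (f k) \<otimes> a \<in> B k" by blast+
  qed
  have fG: "f k \<in> carrier G" if "k \<in> ?K" for k using f(1)[OF that] A_carrier[OF ij(2)] by blast
  have "card ?K \<le> card (?U - {\<one>})"
  proof (rule card_inj_on_le)
    \<comment> \<open>If two indices gave the same component, the difference from \<open>a\<close>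
      would lie in \<open>S\<close>, so \<open>a\<close> would lie in \<open>B j\<close>, which
      meets \<open>A i\<close> trivially.\<close>
    show "inj_on f ?K"
    proof (rule inj_onI, rule ccontr)
      fix k l assume kl: "k \<in> ?K" "l \<in> ?K" "f k = f l" "k \<noteq> l"
      have "inv (f k) \<otimes> a \<in> B k \<inter> B l" using f(2)[OF kl(1)] f(2)[OF kl(2)] kl(3) by simp
      hence "inv (f k) \<otimes> a \<in> S" using B_inter[of k l] kl by blast
      hence "inv (f k) \<otimes> a \<in> B j" using S_subset_B[OF ij(2)] by blast
      hence "a \<in> B j"
        using subgroup_inv_mult_mem_iff[OF B_sub[OF ij(2)] _ aG, of "f k"] f(1)[OF kl(1)]
          A_subset_B[OF ij(2)] by blast
      thus False using B_inter_A[OF ij(2,1)] ij(3) a by blast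
    qed
    show "f ` ?K \<subseteq> ?U - {\<one>}"
    proof (rule image_subsetI)
      fix k assume k: "k \<in> ?K"
      let ?c = "inv (f k) \<otimes> a"
      have kI: "k \<in> I" "k \<noteq> j" using k by blast+
      obtain d where d: "d \<in> B k" "(f k \<otimes> ?c) [^] n = f k [^] n \<otimes> d"
        using pow_mult_normal[OF B_normal[OF kI(1)] fG[OF k] f(2)[OF k]] by blast
      have dG: "d \<in> carrier G" using d(1) B_carrier kI by blast
      \<comment> \<open>The relation \<open>a [^] n = \<one>\<close>, read modulo
        \<open>B k\<close>, puts the power of \<open>f k\<close> into \<open>B k\<close> and so
        makes it trivial.\<close>
      have "f k [^] n \<otimes> d = \<one>" using d(2) a(3) fG[OF k] aG by simp
      hence "f k [^] n = inv d" using inv_equality[of "f k [^] n" d] fG[OF k] dG by simp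
      hence "f k [^] n \<in> B k" using subgroup.m_inv_closed[OF B_sub[OF kI(1)] d(1)] by simp
      moreover have "f k [^] n \<in> A j"
        using Aj.nat_pow_closed[of "f k" n] f(1)[OF k] by (simp add: nat_pow_consistent[symmetric])
      ultimately have "f k [^] n = \<one>" using B_inter_A[OF kI(1) ij(2) kI(2)] by blast
      moreover have "f k \<noteq> \<one>"
      proof
        assume "f k = \<one>"
        hence "a \<in> B k" using f(2)[OF k] aG by simp
        thus False using B_inter_A[OF kI(1) ij(1)] k a by blast
      qed
      ultimately show "f k \<in> ?U - {\<one>}" using f(1)[OF k] by blast
    qed
  qed (use finite_A[OF ij(2)] in simp)
  moreover have "card ?K = t - 1"
    using ij card_I finite_I by (simp add: card_Diff_subset)
  ultimately show ?thesis using U n t_gt by simp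
qed

lemma t_le_s: "t \<le> s"
  by (rule t_le_coprime_factor[OF _ _ s_gt, of 1]) simp_all

text \<open>For equal parameters the sum is even while the square is odd; otherwise the bound on
  coprime factors excludes divisibility.\<close>

lemma sum_not_dvd_square_order:
  assumes "s = t \<and> odd s \<or> s \<noteq> t"
  shows "\<not> s + t dvd s\<^sup>2"
  using assms
proof
  assume st: "s = t \<and> odd s"
  hence "\<not> 2 dvd s\<^sup>2" by (metis even_power)
  moreover have "s + t = 2 * s" using st by simp
  ultimately show ?thesis by (metis dvd_mult_left)
next
  assume "s \<noteq> t"
  thus ?thesis using t_le_s t_gt t_le_coprime_factor by (intro sum_not_dvd_square) auto
qed

text \<open>Each nontrivial element of \<open>A\<^sub>i\<close> is conjugate to its whole \<open>S\<close>-coset, so it fixes exactly one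
  left coset of \<open>M\<close>. As \<open>A\<^sub>i\<close> is abelian, it fixes this coset and acts semiregularly on the others,
  of which there are fewer than \<open>t \<le> s\<close>.\<close>

lemma supplement_eq_carrier:
  assumes st: "s = t \<and> odd s \<or> s \<noteq> t" and M: "subgroup M G" and MS: "M <#> S = carrier G"
  shows "M = carrier G"
proof (rule ccontr)
  assume neq: "M \<noteq> carrier G"
  interpret M: subgroup M G by fact
  interpret S: subgroup S G by (rule S_sub)
  have finM: "finite M" using fin M.subset finite_subset by blast
  have finS: "finite S" using fin S.subset finite_subset by blast
  note nd = sum_not_dvd_square_order[OF st]
  obtain i where i: "i \<in> I" using two_indices by blast
  interpret Ai: subgroup "A i" G by (rule A_sub[OF i])
  \<comment> \<open>\<open>F h\<close> is the union of the left cosets of \<open>M\<close> fixed by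
    \<open>h\<close>.\<close>
  define F where "F h = {x \<in> carrier G. inv x \<otimes> h \<otimes> x \<in> M}" for h
  have MS_ex: "\<exists>m\<in>M. \<exists>\<sigma>\<in>S. x = m \<otimes> \<sigma>" if "x \<in> carrier G" for x
    using that MS unfolding set_mult_def by blast
  have SM_ex: "\<exists>\<sigma>\<in>S. \<exists>m\<in>M. x = \<sigma> \<otimes> m" if "x \<in> carrier G" for x
    using that MS commut_normal[OF M S_normal] unfolding set_mult_def by blast

  \<comment> \<open>The set of elements conjugating \<open>h\<close> to
    \<open>h \<otimes> \<sigma>\<close> is a coset of the centralizer of \<open>h\<close>. All
    \<open>t\<close> of these sets are nonempty and they partition the group, so each has a
    \<open>t\<close>-th of its order.\<close>
  have fiber: "card {x \<in> carrier G. inv x \<otimes> h \<otimes> x = h \<otimes> \<sigma>} = s\<^sup>2"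
    "{x \<in> carrier G. inv x \<otimes> h \<otimes> x = h \<otimes> \<sigma>} \<noteq> {}"
    if h: "h \<in> A i" "h \<noteq> \<one>" and \<sigma>: "\<sigma> \<in> S" for h \<sigma>
  proof -
    define E where "E \<sigma> = {x \<in> carrier G. inv x \<otimes> h \<otimes> x = h \<otimes> \<sigma>}" for \<sigma>
    have hB: "h \<in> B i" using h A_subset_B[OF i] by blast
    have ne: "\<exists>g\<in>carrier G. inv g \<otimes> h \<otimes> g = h \<otimes> \<sigma>" if \<sigma>: "\<sigma> \<in> S" for \<sigma>
    proof -
      interpret Bi: subgroup "B i" G by (rule B_sub[OF i])
      have KB: "h \<otimes> \<sigma> \<in> B i" using hB \<sigma> S_subset_B[OF i] by blast
      have "h \<notin> S" using A_S[OF i] h by blast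
      have KS: "h \<otimes> \<sigma> \<notin> S"
      proof
        assume "h \<otimes> \<sigma> \<in> S"
        hence "h \<otimes> \<sigma> \<otimes> inv \<sigma> \<in> S" using \<sigma> by blast
        thus False using \<open>h \<notin> S\<close> h \<sigma> by (simp add: m_assoc)
      qed
      obtain g where g: "g \<in> carrier G" "inv g \<otimes> (h \<otimes> \<sigma>) \<otimes> g \<in> A i"
        using conj_mem_A[OF nd i KB KS] by blast
      \<comment> \<open>The conjugate found in \<open>A i\<close> is congruent to \<open>h\<close>
        modulo \<open>S\<close>, and \<open>A i\<close> meets \<open>S\<close> trivially, so it is
        \<open>h\<close> itself.\<close>
      have "inv (h \<otimes> \<sigma>) \<otimes> (inv g \<otimes> (h \<otimes> \<sigma>) \<otimes> g) \<in> S"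
        by (rule conj_mod_S[OF i KB g(1)])
      with \<sigma> have "\<sigma> \<otimes> (inv (h \<otimes> \<sigma>) \<otimes> (inv g \<otimes> (h \<otimes> \<sigma>) \<otimes> g)) \<in> S" by (rule S.m_closed)
      moreover have "\<sigma> \<otimes> (inv (h \<otimes> \<sigma>) \<otimes> (inv g \<otimes> (h \<otimes> \<sigma>) \<otimes> g))
          = inv h \<otimes> (inv g \<otimes> (h \<otimes> \<sigma>) \<otimes> g)"
        using h \<sigma> g(1) by (simp add: inv_mult_group m_assoc)
      moreover have "inv h \<otimes> (inv g \<otimes> (h \<otimes> \<sigma>) \<otimes> g) \<in> A i"
        by (rule Ai.m_closed[OF Ai.m_inv_closed[OF h(1)] g(2)])
      ultimately have "inv h \<otimes> (inv g \<otimes> (h \<otimes> \<sigma>) \<otimes> g) = \<one>" using A_S[OF i] by auto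
      hence "h \<otimes> (inv h \<otimes> (inv g \<otimes> (h \<otimes> \<sigma>) \<otimes> g)) = h" using h(1) by simp
      hence "inv g \<otimes> (h \<otimes> \<sigma>) \<otimes> g = h" using h(1) \<sigma> g(1) by simp
      hence "g \<otimes> (inv g \<otimes> (h \<otimes> \<sigma>) \<otimes> g) \<otimes> inv g = g \<otimes> h \<otimes> inv g" by simp
      hence "h \<otimes> \<sigma> = g \<otimes> h \<otimes> inv g" using h(1) \<sigma> g(1) by (simp add: m_assoc)
      thus ?thesis using g(1) by (intro bexI[of _ "inv g"]) simp_all
    qed
    have card_E: "card (E \<sigma>) = card (E \<one>)" if \<sigma>: "\<sigma> \<in> S" for \<sigma>
    proof -
      obtain g where g: "g \<in> carrier G" "inv g \<otimes> h \<otimes> g = h \<otimes> \<sigma>" using ne[OF \<sigma>] by blast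
      have comm_iff: "(inv x \<otimes> h \<otimes> x = h) = (h \<otimes> x = x \<otimes> h)" if x: "x \<in> carrier G" for x
        using x h(1) by (metis Ai.mem_carrier inv_closed m_assoc m_closed inv_cancel_left)
      have "bij_betw (\<lambda>x. x \<otimes> inv g) (E \<sigma>) (E \<one>)"
      proof (rule bij_betw_byWitness[where f' = "\<lambda>x. x \<otimes> g"])
        show "(\<lambda>x. x \<otimes> inv g) ` E \<sigma> \<subseteq> E \<one>"
        proof (rule image_subsetI)
          fix x assume x: "x \<in> E \<sigma>"
          hence xG: "x \<in> carrier G" and e: "inv x \<otimes> h \<otimes> x = inv g \<otimes> h \<otimes> g"
            by (simp_all add: E_def g(2))
          have "inv (x \<otimes> inv g) \<otimes> h \<otimes> (x \<otimes> inv g) = g \<otimes> (inv x \<otimes> h \<otimes> x) \<otimes> inv g"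
            using xG g(1) h(1) by (simp add: inv_mult_group m_assoc)
          also have "\<dots> = h" unfolding e using g(1) h(1) by (simp add: m_assoc)
          finally show "x \<otimes> inv g \<in> E \<one>" using xG g(1) h(1) by (simp add: E_def)
        qed
        show "(\<lambda>x. x \<otimes> g) ` E \<one> \<subseteq> E \<sigma>"
        proof (rule image_subsetI)
          fix x assume x: "x \<in> E \<one>"
          hence xG: "x \<in> carrier G" and e: "inv x \<otimes> h \<otimes> x = h" using h(1) by (simp_all add: E_def)
          have "inv (x \<otimes> g) \<otimes> h \<otimes> (x \<otimes> g) = inv g \<otimes> (inv x \<otimes> h \<otimes> x) \<otimes> g"
            using xG g(1) h(1) by (simp add: inv_mult_group m_assoc)
          also have "\<dots> = h \<otimes> \<sigma>" unfolding e by (rule g(2))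
          finally show "x \<otimes> g \<in> E \<sigma>" using xG g(1) by (simp add: E_def)
        qed
      qed (use g(1) in \<open>auto simp: E_def m_assoc\<close>)
      thus ?thesis by (rule bij_betw_same_card)
    qed
    have "carrier G = (\<Union>\<sigma>\<in>S. E \<sigma>)"
    proof
      show "carrier G \<subseteq> (\<Union>\<sigma>\<in>S. E \<sigma>)"
      proof
        fix x assume x: "x \<in> carrier G"
        have "inv h \<otimes> (inv x \<otimes> h \<otimes> x) \<in> S" by (rule conj_mod_S[OF i hB x])
        moreover have "x \<in> E (inv h \<otimes> (inv x \<otimes> h \<otimes> x))" using x h(1) by (simp add: E_def)
        ultimately show "x \<in> (\<Union>\<sigma>\<in>S. E \<sigma>)" by blast
      qed
    qed (auto simp: E_def)
    hence "card (carrier G) = card (\<Union>\<sigma>\<in>S. E \<sigma>)" by simp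
    also have "\<dots> = (\<Sum>\<sigma>\<in>S. card (E \<sigma>))"
    proof (rule card_UN_disjoint[OF finS])
      show "\<forall>\<sigma>\<in>S. finite (E \<sigma>)" using fin by (simp add: E_def)
      show "\<forall>\<sigma>\<in>S. \<forall>\<tau>\<in>S. \<sigma> \<noteq> \<tau> \<longrightarrow> E \<sigma> \<inter> E \<tau> = {}" using h(1) by (auto simp: E_def)
    qed
    also have "\<dots> = (\<Sum>\<sigma>\<in>S. card (E \<one>))" by (rule sum.cong[OF refl card_E])
    also have "\<dots> = t * card (E \<one>)" using card_S by simp
    finally have "card (E \<one>) = s\<^sup>2" using card_G t_gt by simp
    thus "card {x \<in> carrier G. inv x \<otimes> h \<otimes> x = h \<otimes> \<sigma>} = s\<^sup>2"
      using card_E[OF \<sigma>] unfolding E_def[of \<sigma>] by simp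
    show "{x \<in> carrier G. inv x \<otimes> h \<otimes> x = h \<otimes> \<sigma>} \<noteq> {}" using ne[OF \<sigma>] by blast
  qed

  \<comment> \<open>One half of the product formula for \<open>M\<close> and \<open>S\<close>. The
    injection sends a pair to two components whose product recovers \<open>x\<close>, and the first
    component then recovers \<open>r\<close>.\<close>
  have card_M: "s\<^sup>2 * card (M \<inter> S) \<le> card M"
  proof -
    obtain f where f: "\<And>x. x \<in> carrier G \<Longrightarrow> f x \<in> M \<and> inv (f x) \<otimes> x \<in> S"
    proof -
      have "\<exists>m. m \<in> M \<and> inv m \<otimes> x \<in> S" if "x \<in> carrier G" for x
        using MS_ex[OF that] by auto
      thus ?thesis using that by metis
    qed
    have "card (carrier G \<times> (M \<inter> S)) \<le> card (M \<times> S)"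
    proof (rule card_inj_on_le)
      show "inj_on (\<lambda>(x, r). (f x \<otimes> r, inv r \<otimes> (inv (f x) \<otimes> x))) (carrier G \<times> (M \<inter> S))"
      proof (rule inj_onI)
        fix p q
        assume p: "p \<in> carrier G \<times> (M \<inter> S)" and q: "q \<in> carrier G \<times> (M \<inter> S)"
          and eq: "(case p of (x, r) \<Rightarrow> (f x \<otimes> r, inv r \<otimes> (inv (f x) \<otimes> x)))
            = (case q of (x, r) \<Rightarrow> (f x \<otimes> r, inv r \<otimes> (inv (f x) \<otimes> x)))"
        obtain x r y u where xr: "p = (x, r)" "q = (y, u)" by (metis prod.exhaust)
        have c: "x \<in> carrier G" "y \<in> carrier G" "r \<in> M" "u \<in> M" "f x \<in> M" "f y \<in> M"
          using p q f unfolding xr by blast+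
        have e: "f x \<otimes> r = f y \<otimes> u"
          "inv r \<otimes> (inv (f x) \<otimes> x) = inv u \<otimes> (inv (f y) \<otimes> y)"
          using eq unfolding xr by auto
        have "x = (f x \<otimes> r) \<otimes> (inv r \<otimes> (inv (f x) \<otimes> x))" using c by (simp add: m_assoc)
        also have "\<dots> = (f y \<otimes> u) \<otimes> (inv u \<otimes> (inv (f y) \<otimes> y))" unfolding e ..
        also have "\<dots> = y" using c by (simp add: m_assoc)
        finally have xy: "x = y" .
        have "r = u" using e(1) c unfolding xy by simp
        thus "p = q" using xr xy by simp
      qed
      show "(\<lambda>(x, r). (f x \<otimes> r, inv r \<otimes> (inv (f x) \<otimes> x))) ` (carrier G \<times> (M \<inter> S)) \<subseteq> M \<times> S"
      proof (rule image_subsetI)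
        fix p assume "p \<in> carrier G \<times> (M \<inter> S)"
        then obtain x r where xr: "p = (x, r)" "x \<in> carrier G" "r \<in> M" "r \<in> S" by blast
        have "f x \<otimes> r \<in> M" "inv r \<otimes> (inv (f x) \<otimes> x) \<in> S"
          using f[OF xr(2)] xr(3,4) M.m_closed S.m_closed S.m_inv_closed by simp_all
        thus "(case p of (x, r) \<Rightarrow> (f x \<otimes> r, inv r \<otimes> (inv (f x) \<otimes> x))) \<in> M \<times> S"
          by (simp add: xr(1))
      qed
    qed (use finM finS in simp)
    hence "t * (s\<^sup>2 * card (M \<inter> S)) \<le> t * card M"
      by (simp add: card_cartesian_product card_G card_S mult_ac)
    thus ?thesis using t_gt by simp
  qed

  \<comment> \<open>\<open>F h\<close> contains the coset of \<open>x0\<close>. It is covered by the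
    fibres over \<open>T\<close>, which has at most \<open>card (M \<inter> S)\<close> elements, so
    by \<open>card_M\<close> it is no larger than one coset.\<close>
  have F_coset: "F h = {x \<in> carrier G. inv x0 \<otimes> x \<in> M}" if h: "h \<in> A i" "h \<noteq> \<one>" and x0: "x0 \<in> F h" for h x0
  proof -
    have x0G: "x0 \<in> carrier G" and x0M: "inv x0 \<otimes> h \<otimes> x0 \<in> M" using x0 by (auto simp: F_def)
    let ?C = "{x \<in> carrier G. inv x0 \<otimes> x \<in> M}"
    have hB: "h \<in> B i" using h A_subset_B[OF i] by blast
    define T where "T = {\<sigma> \<in> S. h \<otimes> \<sigma> \<in> M}"
    have finT: "finite T" using finS by (simp add: T_def)
    have sub: "?C \<subseteq> F h"
    proof
      fix x assume x: "x \<in> ?C"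
      let ?m = "inv x0 \<otimes> x"
      have xG: "x \<in> carrier G" and m: "?m \<in> M" using x by auto
      have "inv ?m \<otimes> (inv x0 \<otimes> h \<otimes> x0) \<otimes> ?m \<in> M"
        by (rule M.m_closed[OF M.m_closed[OF M.m_inv_closed[OF m] x0M] m])
      also have "inv ?m \<otimes> (inv x0 \<otimes> h \<otimes> x0) \<otimes> ?m = inv x \<otimes> h \<otimes> x"
        using xG x0G h(1) by (simp add: inv_mult_group m_assoc)
      finally show "x \<in> F h" using xG by (simp add: F_def)
    qed
    have "F h \<subseteq> (\<Union>\<sigma>\<in>T. {x \<in> carrier G. inv x \<otimes> h \<otimes> x = h \<otimes> \<sigma>})"
    proof
      fix x assume x: "x \<in> F h"
      hence xG: "x \<in> carrier G" and xM: "inv x \<otimes> h \<otimes> x \<in> M" by (auto simp: F_def)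
      let ?\<sigma> = "inv h \<otimes> (inv x \<otimes> h \<otimes> x)"
      have "?\<sigma> \<in> S" by (rule conj_mod_S[OF i hB xG])
      moreover have e: "h \<otimes> ?\<sigma> = inv x \<otimes> h \<otimes> x" using xG h(1) by simp
      ultimately have "?\<sigma> \<in> T" using xM by (simp add: T_def)
      moreover have "x \<in> {x \<in> carrier G. inv x \<otimes> h \<otimes> x = h \<otimes> ?\<sigma>}" using e xG by simp
      ultimately show "x \<in> (\<Union>\<sigma>\<in>T. {x \<in> carrier G. inv x \<otimes> h \<otimes> x = h \<otimes> \<sigma>})" by (rule UN_I)
    qed
    hence "card (F h) \<le> card (\<Union>\<sigma>\<in>T. {x \<in> carrier G. inv x \<otimes> h \<otimes> x = h \<otimes> \<sigma>})"
      using finT fin by (intro card_mono) auto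
    also have "\<dots> \<le> (\<Sum>\<sigma>\<in>T. card {x \<in> carrier G. inv x \<otimes> h \<otimes> x = h \<otimes> \<sigma>})"
      by (rule card_UN_le[OF finT])
    also have "\<dots> = (\<Sum>\<sigma>\<in>T. s\<^sup>2)"
      by (rule sum.cong[OF refl], rule fiber(1)[OF h]) (simp add: T_def)
    also have "\<dots> = s\<^sup>2 * card T" by simp
    also have "card T \<le> card (M \<inter> S)"
    proof (cases "T = {}")
      case False
      then obtain \<sigma>0 where s0: "\<sigma>0 \<in> S" "h \<otimes> \<sigma>0 \<in> M" by (auto simp: T_def)
      show ?thesis
      proof (rule card_inj_on_le)
        show "inj_on (\<lambda>\<sigma>. inv \<sigma>0 \<otimes> \<sigma>) T" using s0 by (intro inj_onI) (simp add: T_def)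
        show "(\<lambda>\<sigma>. inv \<sigma>0 \<otimes> \<sigma>) ` T \<subseteq> M \<inter> S"
        proof (rule image_subsetI)
          fix \<sigma> assume "\<sigma> \<in> T"
          hence \<sigma>: "\<sigma> \<in> S" "h \<otimes> \<sigma> \<in> M" by (auto simp: T_def)
          have "inv (h \<otimes> \<sigma>0) \<otimes> (h \<otimes> \<sigma>) \<in> M"
            by (rule M.m_closed[OF M.m_inv_closed[OF s0(2)] \<sigma>(2)])
          also have "inv (h \<otimes> \<sigma>0) \<otimes> (h \<otimes> \<sigma>) = inv \<sigma>0 \<otimes> \<sigma>"
            using h(1) s0(1) \<sigma>(1) by (simp add: inv_mult_group m_assoc)
          finally show "inv \<sigma>0 \<otimes> \<sigma> \<in> M \<inter> S"
            using S.m_closed[OF S.m_inv_closed[OF s0(1)] \<sigma>(1)] by blast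
        qed
      qed (use finM in simp)
    qed simp
    hence "s\<^sup>2 * card T \<le> card M" using card_M by (meson le_trans mult_le_mono2)
    also have "card M = card ?C"
      by (rule bij_betw_same_card[OF bij_betw_byWitness[where f = "\<lambda>m. x0 \<otimes> m"
              and f' = "\<lambda>x. inv x0 \<otimes> x"]]) (use x0G in auto)
    finally have "card (F h) \<le> card ?C" .
    moreover have "finite (F h)" using fin by (simp add: F_def)
    ultimately show ?thesis using sub by (metis card_seteq)
  qed

  have "card (A i) > 1" using card_A[OF i] s_gt by simp
  hence "\<not> A i \<subseteq> {\<one>}" using card_mono[of "{\<one>}" "A i"] by auto
  then obtain h where h: "h \<in> A i" "h \<noteq> \<one>" by blast
  \<comment> \<open>Modulo \<open>S\<close> the element \<open>h\<close> agrees with some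
    \<open>m\<close> in \<open>M\<close>, and by \<open>fiber\<close> it is conjugate to
    \<open>m\<close>; hence \<open>h\<close> fixes at least one coset.\<close>
  obtain x0 where x0: "x0 \<in> F h"
  proof -
    obtain m \<sigma> where m: "m \<in> M" "\<sigma> \<in> S" "h = m \<otimes> \<sigma>" using MS_ex[OF Ai.mem_carrier[OF h(1)]] by blast
    hence "h \<otimes> inv \<sigma> = m" by (simp add: m_assoc)
    moreover obtain x where "x \<in> carrier G" "inv x \<otimes> h \<otimes> x = h \<otimes> inv \<sigma>"
      using fiber(2)[OF h S.m_inv_closed[OF m(2)]] by blast
    ultimately have "x \<in> F h" using m(1) by (simp add: F_def)
    thus ?thesis by (rule that)
  qed
  have x0G: "x0 \<in> carrier G" using x0 by (simp add: F_def)
  \<comment> \<open>Since \<open>a\<close> commutes with \<open>h\<close>, it permutes the cosets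
    fixed by \<open>h\<close>; there is only one, so \<open>a\<close> fixes it.\<close>
  have x0_all: "inv x0 \<otimes> a \<otimes> x0 \<in> M" if a: "a \<in> A i" for a
  proof -
    have "inv (a \<otimes> x0) \<otimes> h \<otimes> (a \<otimes> x0) = inv x0 \<otimes> (inv a \<otimes> (h \<otimes> a)) \<otimes> x0"
      using a h(1) x0G by (simp add: inv_mult_group m_assoc)
    also have "\<dots> = inv x0 \<otimes> h \<otimes> x0"
      using A_comm[OF i h(1) a] a h(1) by simp
    finally have "a \<otimes> x0 \<in> F h" using x0 a by (simp add: F_def)
    hence "inv x0 \<otimes> (a \<otimes> x0) \<in> M" using F_coset[OF h x0] by blast
    thus ?thesis using a x0G by (simp add: m_assoc)
  qed
  have F_all: "inv x0 \<otimes> x \<in> M" if "a \<in> A i" "a \<noteq> \<one>" "x \<in> carrier G" "inv x \<otimes> a \<otimes> x \<in> M" for a x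
  proof -
    have "x0 \<in> F a" using x0_all[OF that(1)] x0G by (simp add: F_def)
    moreover have "x \<in> F a" using that by (simp add: F_def)
    ultimately show ?thesis using F_coset[OF that(1,2)] by blast
  qed
  obtain z where z: "z \<in> carrier G" "z \<notin> M" using neq M.subset by blast
  define y where "y = x0 \<otimes> z"
  have y: "y \<in> carrier G" "inv x0 \<otimes> y \<notin> M" using z x0G by (simp_all add: y_def)
  \<comment> \<open>\<open>f\<close> picks an element of \<open>S\<close> in the left coset of
    \<open>x\<close>; equal values mean equal cosets, so there are at most \<open>t\<close>
    cosets.\<close>
  obtain f where f: "\<And>x. x \<in> carrier G \<Longrightarrow> f x \<in> S \<and> inv (f x) \<otimes> x \<in> M"
  proof -
    have "\<exists>\<sigma>. \<sigma> \<in> S \<and> inv \<sigma> \<otimes> x \<in> M" if "x \<in> carrier G" for x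
      using SM_ex[OF that] by auto
    thus ?thesis using that by metis
  qed
  have f_eq: "inv u \<otimes> v \<in> M" if "f u = f v" "u \<in> carrier G" "v \<in> carrier G" for u v
  proof -
    have fu: "f u \<in> carrier G" using f[OF that(2)] by simp
    have "inv (inv (f u) \<otimes> u) \<otimes> (inv (f v) \<otimes> v) \<in> M"
      using f[OF that(2)] f[OF that(3)] M.m_closed[OF M.m_inv_closed] by blast
    also have "inv (inv (f u) \<otimes> u) \<otimes> (inv (f v) \<otimes> v) = inv u \<otimes> v"
      unfolding that(1)[symmetric] using that(2,3) fu by (simp add: inv_mult_group m_assoc)
    finally show ?thesis .
  qed
  \<comment> \<open>The coset of \<open>x0\<close> and the \<open>s\<close> translates of the coset
    of \<open>y\<close> are pairwise distinct, which would require
    \<open>s + 1 \<le> t\<close>.\<close>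
  have "card (insert x0 ((\<lambda>a. a \<otimes> y) ` A i)) \<le> card S"
  proof (rule card_inj_on_le[OF _ _ finS])
    have noteq: "f (a \<otimes> y) \<noteq> f x0" if a: "a \<in> A i" for a
    proof
      assume "f (a \<otimes> y) = f x0"
      hence "inv x0 \<otimes> (a \<otimes> y) \<in> M" using f_eq[of x0 "a \<otimes> y"] a x0G y(1) by simp
      hence "inv (inv x0 \<otimes> a \<otimes> x0) \<otimes> (inv x0 \<otimes> (a \<otimes> y)) \<in> M"
        by (rule M.m_closed[OF M.m_inv_closed[OF x0_all[OF a]]])
      also have "inv (inv x0 \<otimes> a \<otimes> x0) \<otimes> (inv x0 \<otimes> (a \<otimes> y)) = inv x0 \<otimes> y"
        using a x0G y(1) by (simp add: inv_mult_group m_assoc)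
      finally show False using y(2) by blast
    qed
    have "a = b" if ab: "a \<in> A i" "b \<in> A i" "f (a \<otimes> y) = f (b \<otimes> y)" for a b
    proof (rule ccontr)
      assume neq: "a \<noteq> b"
      have "inv (a \<otimes> y) \<otimes> (b \<otimes> y) \<in> M" using f_eq[OF ab(3)] ab y(1) by simp
      hence "inv y \<otimes> (inv a \<otimes> b) \<otimes> y \<in> M" using ab y(1) by (simp add: inv_mult_group m_assoc)
      moreover have "inv a \<otimes> b \<noteq> \<one>"
      proof
        assume "inv a \<otimes> b = \<one>"
        hence "a \<otimes> (inv a \<otimes> b) = a" using ab by simp
        thus False using neq ab by simp
      qed
      moreover have "inv a \<otimes> b \<in> A i" using ab by blast
      ultimately show False using F_all[of "inv a \<otimes> b" y] y by blast
    qed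
    thus "inj_on f (insert x0 ((\<lambda>a. a \<otimes> y) ` A i))"
      using noteq by (auto simp: inj_on_def dest: sym)
    show "f ` insert x0 ((\<lambda>a. a \<otimes> y) ` A i) \<subseteq> S" using f x0G y(1) by auto
  qed
  moreover have "x0 \<notin> (\<lambda>a. a \<otimes> y) ` A i"
  proof
    assume "x0 \<in> (\<lambda>a. a \<otimes> y) ` A i"
    then obtain a where a: "a \<in> A i" "x0 = a \<otimes> y" by blast
    have "inv x0 \<otimes> inv a \<otimes> x0 \<in> M" by (rule x0_all[OF Ai.m_inv_closed[OF a(1)]])
    moreover have "inv x0 \<otimes> inv a \<otimes> x0 = inv x0 \<otimes> y" using a y(1) x0G by (subst (2) a(2)) (simp add: m_assoc)
    ultimately show False using y(2) by simp
  qed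
  moreover have "card ((\<lambda>a. a \<otimes> y) ` A i) = s"
    using card_A[OF i] y(1) by (subst card_image) (auto intro: inj_onI)
  ultimately have "s + 1 \<le> t" using finite_A[OF i] card_S by simp
  thus False using t_le_s by simp
qed

end

section \<open>The Kantor family of a skew translation quadrangle\<close>

locale skew_translation_quadrangle =
  fixes P :: "'p set" and L :: "'p set set" and s t :: nat and x :: 'p
    and H S :: "('p \<Rightarrow> 'p) set"
  assumes skew: "skew_translation_GQ P L s t x H S"
begin

abbreviation G :: "('p \<Rightarrow> 'p) monoid" where "G \<equiv> (BijGroup P)\<lparr>carrier := H\<rparr>"

abbreviation col :: "'p \<Rightarrow> 'p \<Rightarrow> bool" where "col \<equiv> collinear L"

lemma elation: "elation_GQ P L s t x H" and S_H: "S \<subseteq> H" and card_S: "card S = t"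
  and S_normal: "S \<lhd> G"
  and S_fix: "g \<in> S \<Longrightarrow> y \<in> P \<Longrightarrow> col x y \<Longrightarrow> g y = y"
  using skew by (simp_all add: skew_translation_GQ_def symmetry_about_def)

lemma xP: "x \<in> P" and finP: "finite P" and GQ: "GQ P L s t" and s_gt: "s > 1" and t_gt: "t > 1"
  and H_sub: "subgroup H (BijGroup P)" and H_aut: "H \<subseteq> GQ_aut P L"
  and H_line: "h \<in> H \<Longrightarrow> l \<in> L \<Longrightarrow> x \<in> l \<Longrightarrow> h ` l = l"
  and H_sharp: "p \<in> P \<Longrightarrow> q \<in> P \<Longrightarrow> \<not> col x p \<Longrightarrow> \<not> col x q \<Longrightarrow> \<exists>!h. h \<in> H \<and> h p = q"
  using elation by (simp_all add: elation_GQ_def finite_thick_GQ_def)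

lemma line_sub: "l \<in> L \<Longrightarrow> l \<subseteq> P" and card_line: "l \<in> L \<Longrightarrow> card l = s + 1"
  and card_pencil: "p \<in> P \<Longrightarrow> card {l\<in>L. p \<in> l} = t + 1"
  and project: "p \<in> P \<Longrightarrow> l \<in> L \<Longrightarrow> p \<notin> l \<Longrightarrow> \<exists>!q. q \<in> l \<and> col p q"
  using GQ by (simp_all add: GQ_def)

lemma finite_line: "l \<in> L \<Longrightarrow> finite l" by (rule finite_subset[OF line_sub finP])

lemma line_unique:
  assumes "k \<in> L" "l \<in> L" "p \<in> k" "q \<in> k" "p \<in> l" "q \<in> l" "p \<noteq> q"
  shows "k = l"
proof -
  have pq: "p \<in> P" "q \<in> P" using line_sub assms by blast+
  have "L \<subseteq> Pow P" using line_sub by blast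
  hence "finite L" by (rule finite_subset) (simp add: finP)
  hence fin: "finite {l\<in>L. p \<in> l \<and> q \<in> l}" by simp
  have "card {l\<in>L. p \<in> l \<and> q \<in> l} \<le> Suc 0" using GQ pq assms(7) by (simp add: GQ_def)
  hence "\<forall>k\<in>{l\<in>L. p \<in> l \<and> q \<in> l}. \<forall>l\<in>{l\<in>L. p \<in> l \<and> q \<in> l}. k = l"
    by (simp only: card_le_Suc0_iff_eq[OF fin])
  moreover have "k \<in> {l\<in>L. p \<in> l \<and> q \<in> l}" "l \<in> {l\<in>L. p \<in> l \<and> q \<in> l}" using assms by simp_all
  ultimately show ?thesis by blast
qed

lemma col_sym: "col p q \<longleftrightarrow> col q p"
  by (auto simp: collinear_def)

lemma colI: "l \<in> L \<Longrightarrow> p \<in> l \<Longrightarrow> q \<in> l \<Longrightarrow> col p q"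
  by (auto simp: collinear_def)

lemma colE:
  assumes "col p q" obtains l where "l \<in> L" "p \<in> l" "q \<in> l"
  using assms by (auto simp: collinear_def)

text \<open>Otherwise \<open>p\<close> would have two projections onto \<open>l\<close>.\<close>

lemma no_triangle:
  assumes "l \<in> L" "p \<in> P" "q \<in> l" "r \<in> l" "col p q" "col p r" "p \<notin> l"
  shows "q = r"
  using project[OF assms(2,1,7)] assms(3-6) by blast

section \<open>The action of \<open>H\<close> on points and lines\<close>

lemma H_bij: "h \<in> H \<Longrightarrow> bij_betw h P P"
  using H_aut by (auto simp: GQ_aut_def Bij_def)

lemma H_closed: "h \<in> H \<Longrightarrow> p \<in> P \<Longrightarrow> h p \<in> P"
  using H_bij by (auto simp: bij_betw_def)

lemma H_image: "h \<in> H \<Longrightarrow> l \<in> L \<Longrightarrow> h ` l \<in> L"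
  using H_aut line_sub by (auto simp: GQ_aut_def)

lemma H_col: "h \<in> H \<Longrightarrow> col p q \<Longrightarrow> col (h p) (h q)"
  by (elim colE) (rule colI[OF H_image imageI imageI])

sublocale group G
  using subgroup.subgroup_is_group[OF H_sub group_BijGroup] .

lemma mult_apply: "g \<in> H \<Longrightarrow> h \<in> H \<Longrightarrow> p \<in> P \<Longrightarrow> (g \<otimes>\<^bsub>G\<^esub> h) p = g (h p)"
  using H_aut by (auto simp: GQ_aut_def BijGroup_def compose_def subset_iff)

lemma one_apply: "p \<in> P \<Longrightarrow> \<one>\<^bsub>G\<^esub> p = p"
  by (simp add: BijGroup_def)

lemma inv_apply:
  assumes "h \<in> H" "p \<in> P"
  shows "(inv\<^bsub>G\<^esub> h) (h p) = p" "h ((inv\<^bsub>G\<^esub> h) p) = p"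
proof -
  have i: "inv\<^bsub>G\<^esub> h \<in> H" using inv_closed[of h] assms by simp
  show "(inv\<^bsub>G\<^esub> h) (h p) = p"
    using mult_apply[OF i assms] l_inv[of h] one_apply assms by simp
  show "h ((inv\<^bsub>G\<^esub> h) p) = p"
    using mult_apply[OF assms(1) i assms(2)] r_inv[of h] one_apply assms by simp
qed

lemma inv_H: "h \<in> H \<Longrightarrow> inv\<^bsub>G\<^esub> h \<in> H" using inv_closed[of h] by simp

lemma mult_H: "g \<in> H \<Longrightarrow> h \<in> H \<Longrightarrow> g \<otimes>\<^bsub>G\<^esub> h \<in> H" using m_closed[of g h] by simp

lemma pencil_nonempty: "p \<in> P \<Longrightarrow> \<exists>l\<in>L. p \<in> l"
  using card_pencil[of p] by (cases "{l\<in>L. p \<in> l} = {}") auto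

lemma another_line:
  assumes "p \<in> P" "k \<in> L"
  obtains l where "l \<in> L" "p \<in> l" "l \<noteq> k"
proof -
  have "\<not> {l\<in>L. p \<in> l} \<subseteq> {k}"
    using card_mono[of "{k}" "{l\<in>L. p \<in> l}"] card_pencil[OF assms(1)] t_gt by auto
  thus ?thesis using that by blast
qed

lemma another_point:
  assumes "l \<in> L"
  obtains p where "p \<in> l" "p \<noteq> q"
proof -
  have "\<not> l \<subseteq> {q}" using card_mono[of "{q}" l] card_line[OF assms] s_gt by auto
  thus ?thesis using that by blast
qed

text \<open>Two distinct lines through \<open>x\<close> are both stabilized and meet only in
  \<open>x\<close>.\<close>

lemma fix_x: "h \<in> H \<Longrightarrow> h x = x"
proof -
  assume h: "h \<in> H"
  obtain l where l: "l \<in> L" "x \<in> l" using pencil_nonempty[OF xP] by blast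
  obtain k where k: "k \<in> L" "x \<in> k" "k \<noteq> l" using another_line[OF xP l(1)] by blast
  have "h x \<in> l" "h x \<in> k" using H_line[OF h l] H_line[OF h k(1,2)] l(2) k(2) by blast+
  thus "h x = x" using line_unique[OF k(1) l(1)] k l by blast
qed

lemma H_noncol:
  assumes h: "h \<in> H" and p: "p \<in> P" "\<not> col x p"
  shows "\<not> col x (h p)"
proof
  assume "col x (h p)"
  hence "col ((inv\<^bsub>G\<^esub> h) x) ((inv\<^bsub>G\<^esub> h) (h p))" by (rule H_col[OF inv_H[OF h]])
  thus False using p fix_x[OF inv_H[OF h]] inv_apply(1)[OF h p(1)] by simp
qed

text \<open>Leave \<open>x\<close> along a line to \<open>y\<close>, then leave \<open>y\<close>
  along a different line; collinearity of the endpoint with \<open>x\<close> would close a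
  triangle.\<close>

lemma exists_noncol: "\<exists>z\<in>P. \<not> col x z"
proof -
  obtain l where l: "l \<in> L" "x \<in> l" using pencil_nonempty[OF xP] by blast
  obtain y where y: "y \<in> l" "y \<noteq> x" using another_point[OF l(1)] by blast
  have yP: "y \<in> P" using line_sub l y by blast
  obtain m where m: "m \<in> L" "y \<in> m" "m \<noteq> l" using another_line[OF yP l(1)] by blast
  obtain z where z: "z \<in> m" "z \<noteq> y" using another_point[OF m(1)] by blast
  have zP: "z \<in> P" using line_sub m z by blast
  have "z \<notin> l" using line_unique[OF m(1) l(1)] z m(2,3) y(1) by blast
  moreover have "col z y" using colI m z by blast
  ultimately have "\<not> col z x" using no_triangle[OF l(1) zP l(2) y(1)] y(2) by blast
  thus ?thesis using zP col_sym by blast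
qed

section \<open>The base point, feet and joining lines\<close>

definition z :: 'p where "z = (SOME z. z \<in> P \<and> \<not> col x z)"

lemma zP: "z \<in> P" and z_noncol: "\<not> col x z"
  using exists_noncol someI_ex[of "\<lambda>z. z \<in> P \<and> \<not> col x z"] by (auto simp: z_def)

text \<open>The lines through \<open>x\<close> serve as indices because \<open>H\<close> stabilizes
  each of them; every line through \<open>z\<close> meets exactly one.\<close>

definition I :: "'p set set" where "I = {l\<in>L. x \<in> l}"

definition foot :: "'p set \<Rightarrow> 'p" where "foot l = (THE q. q \<in> l \<and> col z q)"

definition line :: "'p set \<Rightarrow> 'p set" where "line l = (THE m. m \<in> L \<and> z \<in> m \<and> foot l \<in> m)"

text \<open>Only the image of \<open>z\<close> is tested; \<open>A_image\<close> shows that this is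
  the stabilizer of \<open>line l\<close>.\<close>

definition A :: "'p set \<Rightarrow> ('p \<Rightarrow> 'p) set" where "A l = {h\<in>H. h z \<in> line l}"

lemma I_D: "l \<in> I \<Longrightarrow> l \<in> L" "l \<in> I \<Longrightarrow> x \<in> l" by (auto simp: I_def)

lemma noncol_notin: "l \<in> I \<Longrightarrow> \<not> col x p \<Longrightarrow> p \<notin> l"
  using colI[of l x p] by (auto simp: I_def)

lemma foot:
  assumes "l \<in> I"
  shows "foot l \<in> l" "col z (foot l)" "foot l \<in> P" "foot l \<noteq> x" "col x (foot l)" "foot l \<noteq> z"
proof -
  have "\<exists>!q. q \<in> l \<and> col z q"
    by (rule project[OF zP I_D(1)[OF assms] noncol_notin[OF assms z_noncol]])
  hence "foot l \<in> l \<and> col z (foot l)" unfolding foot_def by (rule theI')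
  thus 1: "foot l \<in> l" "col z (foot l)" by blast+
  thus "foot l \<in> P" using line_sub[OF I_D(1)[OF assms]] by blast
  show "foot l \<noteq> x" using 1(2) z_noncol col_sym[of z x] by auto
  show c: "col x (foot l)" by (rule colI[OF I_D(1)[OF assms] I_D(2)[OF assms] 1(1)])
  show "foot l \<noteq> z" using c z_noncol by auto
qed

lemma line:
  assumes l: "l \<in> I"
  shows "line l \<in> L" "z \<in> line l" "foot l \<in> line l"
proof -
  obtain m where m: "m \<in> L" "z \<in> m" "foot l \<in> m" using foot(2)[OF l] by (rule colE)
  hence "line l = m" unfolding line_def
    using line_unique foot(6)[OF l] by (intro the_equality) blast+
  thus "line l \<in> L" "z \<in> line l" "foot l \<in> line l" using m by auto
qed

lemma line_col_unique:
  assumes l: "l \<in> I" and p: "p \<in> line l" "col x p"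
  shows "p = foot l"
proof -
  have "x \<notin> line l" using z_noncol colI[OF line(1)[OF l] _ line(2)[OF l]] by blast
  thus ?thesis using no_triangle[OF line(1)[OF l] xP p(1) line(3)[OF l] p(2) foot(5)[OF l]] by blast
qed

lemma foot_inj:
  assumes "l \<in> I" "k \<in> I" "foot l \<in> k"
  shows "l = k"
  by (rule line_unique[OF I_D(1)[OF assms(1)] I_D(1)[OF assms(2)] I_D(2)[OF assms(1)] foot(1)[OF assms(1)]
    I_D(2)[OF assms(2)] assms(3) not_sym[OF foot(4)[OF assms(1)]]])

lemma line_inj:
  assumes "l \<in> I" "k \<in> I" "line l = line k"
  shows "l = k"
proof -
  have "foot l \<in> line k" using line(3)[OF assms(1)] unfolding assms(3) .
  hence "foot l = foot k" by (rule line_col_unique[OF assms(2) _ foot(5)[OF assms(1)]])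
  hence "foot l \<in> k" using foot(1)[OF assms(2)] by simp
  thus ?thesis by (rule foot_inj[OF assms(1,2)])
qed

text \<open>The projection of \<open>x\<close> onto \<open>m\<close> lies on some line
  \<open>l\<close> through \<open>x\<close>, and being collinear with \<open>z\<close> it is the
  foot of \<open>l\<close>.\<close>

lemma line_surj:
  assumes m: "m \<in> L" "z \<in> m"
  shows "\<exists>l\<in>I. m = line l"
proof -
  have "x \<notin> m" using z_noncol colI[OF m(1) _ m(2)] by blast
  then obtain q where q: "q \<in> m" "col x q" using ex1_implies_ex[OF project[OF xP m(1)]] by blast
  obtain l where l: "l \<in> L" "x \<in> l" "q \<in> l" using q(2) by (rule colE)
  have lI: "l \<in> I" using l by (simp add: I_def)
  have "q = foot l"
    using no_triangle[OF l(1) zP l(3) foot(1)[OF lI] colI[OF m q(1)] foot(2)[OF lI]]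
      noncol_notin[OF lI z_noncol] by blast
  hence "foot l \<in> m" using q(1) by simp
  hence "m = line l"
    by (rule line_unique[OF m(1) line(1)[OF lI] m(2) _ line(2)[OF lI] line(3)[OF lI] not_sym[OF foot(6)[OF lI]]])
  thus ?thesis using lI by blast
qed

section \<open>Stabilizers of the lines through the base point\<close>

lemma H_z: "h \<in> H \<Longrightarrow> h z \<in> P" "h \<in> H \<Longrightarrow> \<not> col x (h z)"
  using H_closed zP H_noncol z_noncol by blast+

text \<open>Sharp transitivity identifies elements of \<open>H\<close> with points not collinear
  with \<open>x\<close>.\<close>

lemma H_z_inj:
  assumes g: "g \<in> H" and h: "h \<in> H" and gh: "g z = h z"
  shows "g = h"
  using H_sharp[OF zP H_z(1)[OF g] z_noncol H_z(2)[OF g]] g h gh by metis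

lemma H_z_one: "h \<in> H \<Longrightarrow> h z = z \<Longrightarrow> h = \<one>\<^bsub>G\<^esub>"
  using H_z_inj[of h "\<one>\<^bsub>G\<^esub>"] one_closed one_apply[OF zP] by simp

lemma foot_moved:
  assumes l: "l \<in> I" and h: "h \<in> H"
  shows "h (foot l) \<in> l" "col x (h (foot l))" "col (h z) (h (foot l))" "h (foot l) \<noteq> x"
proof -
  show 1: "h (foot l) \<in> l" using H_line[OF h] I_D[OF l] foot(1)[OF l] by blast
  thus "col x (h (foot l))" using colI I_D[OF l] by blast
  show "col (h z) (h (foot l))" by (rule H_col[OF h foot(2)[OF l]])
  thus "h (foot l) \<noteq> x" using H_z(2)[OF h] col_sym by metis
qed

text \<open>As \<open>l\<close> is stabilized, the image of the foot is the projection of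
  \<open>h z\<close> onto \<open>l\<close>, and projections are unique.\<close>

lemma foot_fixed_iff:
  assumes l: "l \<in> I" and h: "h \<in> H"
  shows "h (foot l) = foot l \<longleftrightarrow> col (h z) (foot l)"
proof
  show "col (h z) (foot l)" if "h (foot l) = foot l" using foot_moved(3)[OF l h] that by simp
  show "h (foot l) = foot l" if "col (h z) (foot l)"
    using no_triangle[OF I_D(1)[OF l] H_z(1)[OF h] foot_moved(1)[OF l h] foot(1)[OF l]
      foot_moved(3)[OF l h] that noncol_notin[OF l H_z(2)[OF h]]] .
qed

lemma A_foot:
  assumes l: "l \<in> I" and h: "h \<in> A l"
  shows "h (foot l) = foot l"
proof -
  have "h \<in> H" "h z \<in> line l" using h by (auto simp: A_def)
  thus ?thesis using foot_fixed_iff[OF l] colI[OF line(1)[OF l] _ line(3)[OF l]] by blast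
qed

text \<open>An element of \<open>A l\<close> fixes the foot, so the image of \<open>line l\<close>
  shares with it the two distinct points \<open>h z\<close> and \<open>foot l\<close>.\<close>

lemma A_image:
  assumes l: "l \<in> I" and h: "h \<in> H"
  shows "h \<in> A l \<longleftrightarrow> h ` line l = line l"
proof
  assume "h \<in> A l"
  hence hz: "h z \<in> line l" by (simp add: A_def)
  have "foot l \<in> h ` line l"
    using A_foot[OF l \<open>h \<in> A l\<close>] line(3)[OF l] by (metis imageI)
  moreover have "h z \<noteq> foot l" using H_z(2)[OF h] foot(5)[OF l] by metis
  ultimately show "h ` line l = line l"
    using line_unique[OF H_image[OF h line(1)[OF l]] line(1)[OF l] _ _ hz line(3)[OF l]] line(2)[OF l]
    by blast
next
  assume "h ` line l = line l"
  thus "h \<in> A l" using line(2)[OF l] h by (auto simp: A_def)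
qed

lemma A_H: "A l \<subseteq> H" by (auto simp: A_def)

lemma mult_image: "g \<in> H \<Longrightarrow> h \<in> H \<Longrightarrow> l \<subseteq> P \<Longrightarrow> (g \<otimes>\<^bsub>G\<^esub> h) ` l = g ` (h ` l)"
  using mult_apply by (force simp: image_image subset_iff)

lemma inv_image:
  assumes "h \<in> H" "l \<subseteq> P"
  shows "(inv\<^bsub>G\<^esub> h) ` (h ` l) = l"
proof -
  have "(inv\<^bsub>G\<^esub> h) ` (h ` l) = (\<lambda>p. p) ` l"
    unfolding image_image using inv_apply(1)[OF assms(1)] assms(2) by (intro image_cong) auto
  thus ?thesis by simp
qed

lemma A_subgroup:
  assumes l: "l \<in> I"
  shows "subgroup (A l) G"
proof (rule subgroupI)
  note lP = line_sub[OF line(1)[OF l]]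
  show "A l \<subseteq> carrier G" using A_H by simp
  have "\<one>\<^bsub>G\<^esub> z = z" by (rule one_apply[OF zP])
  hence "\<one>\<^bsub>G\<^esub> \<in> A l" using one_closed line(2)[OF l] by (simp add: A_def)
  thus "A l \<noteq> {}" by blast
  fix a assume a: "a \<in> A l"
  hence aH: "a \<in> H" using A_H by blast
  have "(inv\<^bsub>G\<^esub> a) ` (a ` line l) = line l" by (rule inv_image[OF aH lP])
  thus "inv\<^bsub>G\<^esub> a \<in> A l" using A_image[OF l aH] A_image[OF l inv_H[OF aH]] a by simp
  fix b assume b: "b \<in> A l"
  hence bH: "b \<in> H" using A_H by blast
  show "a \<otimes>\<^bsub>G\<^esub> b \<in> A l"
    using a b A_image[OF l] mult_H[OF aH bH] mult_image[OF aH bH lP] aH bH by simp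
qed

text \<open>The map to \<open>h z\<close> is a bijection onto the points of \<open>line l\<close>
  other than its foot, the only one collinear with \<open>x\<close>.\<close>

lemma card_A:
  assumes l: "l \<in> I"
  shows "card (A l) = s"
proof -
  have "bij_betw (\<lambda>h. h z) (A l) (line l - {foot l})"
    unfolding bij_betw_def
  proof
    show "inj_on (\<lambda>h. h z) (A l)" using H_z_inj A_H by (auto intro!: inj_onI)
    show "(\<lambda>h. h z) ` A l = line l - {foot l}"
    proof
      show "(\<lambda>h. h z) ` A l \<subseteq> line l - {foot l}"
      proof (rule image_subsetI)
        fix h assume "h \<in> A l"
        hence "h z \<in> line l" "\<not> col x (h z)" using H_z(2) by (auto simp: A_def)
        thus "h z \<in> line l - {foot l}" using foot(5)[OF l] by auto
      qed
      show "line l - {foot l} \<subseteq> (\<lambda>h. h z) ` A l"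
      proof
        fix p assume p: "p \<in> line l - {foot l}"
        hence "p \<in> P" "\<not> col x p" using line_sub line(1)[OF l] line_col_unique[OF l] by blast+
        then obtain h where "h \<in> H" "h z = p" using H_sharp[OF zP _ z_noncol] by blast
        thus "p \<in> (\<lambda>h. h z) ` A l" using p by (auto simp: A_def)
      qed
    qed
  qed
  hence "card (A l) = card (line l - {foot l})" by (rule bij_betw_same_card)
  also have "\<dots> = s" using line[OF l] card_line finite_line by (simp add: card_Diff_singleton)
  finally show ?thesis .
qed

lemma foot_notin_line:
  assumes l: "l \<in> I" "k \<in> I" "l \<noteq> k"
  shows "foot l \<notin> line k"
proof
  assume "foot l \<in> line k"
  hence "foot l = foot k" using line_col_unique[OF l(2)] foot(5)[OF l(1)] by blast
  thus False using foot_inj[OF l(1,2)] foot(1)[OF l(2)] l(3) by simp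
qed

text \<open>A fixed foot of \<open>l\<close> is collinear with both \<open>z\<close> and
  \<open>h z\<close> on \<open>line k\<close>, but is not on that line; so these two points
  coincide.\<close>

lemma fixed_foot_A_one:
  assumes l: "l \<in> I" "k \<in> I" "l \<noteq> k" and h: "h \<in> A k" "h (foot l) = foot l"
  shows "h = \<one>\<^bsub>G\<^esub>"
proof -
  have hH: "h \<in> H" and hz: "h z \<in> line k" using h by (auto simp: A_def)
  have "col (foot l) (h z)" using foot_fixed_iff[OF l(1) hH] h(2) col_sym by blast
  moreover have "col (foot l) z" using foot(2)[OF l(1)] col_sym by blast
  ultimately have "h z = z"
    using no_triangle[OF line(1)[OF l(2)] foot(3)[OF l(1)] hz line(2)[OF l(2)]]
      foot_notin_line[OF l] by blast
  thus ?thesis by (rule H_z_one[OF hH])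
qed

lemma S_foot: "l \<in> I \<Longrightarrow> g \<in> S \<Longrightarrow> g (foot l) = foot l"
  using S_fix foot(3,5) by blast

lemma card_I: "card I = t + 1"
  using card_pencil[OF xP] by (simp add: I_def)

lemma another_index:
  obtains k where "k \<in> I" "k \<noteq> l"
proof -
  have "\<not> I \<subseteq> {l}" using card_mono[of "{l}" I] card_I t_gt by auto
  thus ?thesis using that by blast
qed

text \<open>Symmetries fix all feet, in particular one belonging to a different index.\<close>

lemma A_inter_S:
  assumes l: "l \<in> I"
  shows "A l \<inter> S = {\<one>\<^bsub>G\<^esub>}"
proof -
  obtain k where k: "k \<in> I" "k \<noteq> l" by (rule another_index)
  have "g = \<one>\<^bsub>G\<^esub>" if "g \<in> A l" "g \<in> S" for g
    using fixed_foot_A_one[OF k(1) l k(2) that(1)] S_foot[OF k(1) that(2)] by blast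
  moreover have "\<one>\<^bsub>G\<^esub> \<in> A l" "\<one>\<^bsub>G\<^esub> \<in> S"
    using subgroup.one_closed[OF A_subgroup[OF l]] subgroup.one_closed[OF normal_imp_subgroup[OF S_normal]]
    by blast+
  ultimately show ?thesis by blast
qed

text \<open>\<open>S\<close> permutes the \<open>t\<close> lines other than \<open>l\<close> through the foot of \<open>l\<close> regularly.\<close>

lemma A_S_eq_stabilizer:
  assumes l: "l \<in> I"
  shows "A l <#>\<^bsub>G\<^esub> S = {h\<in>H. h (foot l) = foot l}"
proof
  show "A l <#>\<^bsub>G\<^esub> S \<subseteq> {h\<in>H. h (foot l) = foot l}"
  proof
    fix h assume "h \<in> A l <#>\<^bsub>G\<^esub> S"
    then obtain a g where h: "a \<in> A l" "g \<in> S" "h = a \<otimes>\<^bsub>G\<^esub> g" unfolding set_mult_def by blast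
    have ag: "a \<in> H" "g \<in> H" using h A_H S_H by blast+
    have "(a \<otimes>\<^bsub>G\<^esub> g) (foot l) = foot l"
      using mult_apply[OF ag foot(3)[OF l]] S_foot[OF l h(2)] A_foot[OF l h(1)] by simp
    thus "h \<in> {h\<in>H. h (foot l) = foot l}" using mult_H[OF ag] h(3) by blast
  qed
  show "{h\<in>H. h (foot l) = foot l} \<subseteq> A l <#>\<^bsub>G\<^esub> S"
  proof clarify
    fix h assume h: "h \<in> H" "h (foot l) = foot l"
    note lP = line_sub[OF line(1)[OF l]]
    let ?T = "{m\<in>L. foot l \<in> m} - {l}"
    have mem: "g ` line l \<in> ?T" if "g \<in> H" "g (foot l) = foot l" for g
    proof -
      have "foot l \<in> g ` line l" using line(3)[OF l] that(2) by (metis imageI)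
      moreover have "g z \<notin> l" using noncol_notin[OF l] H_z(2)[OF that(1)] by blast
      hence "g ` line l \<noteq> l" using line(2)[OF l] by blast
      ultimately show ?thesis using H_image[OF that(1) line(1)[OF l]] by blast
    qed
    have inj: "inj_on (\<lambda>g. g ` line l) S"
    proof (rule inj_onI)
      fix g k assume gk: "g \<in> S" "k \<in> S" "g ` line l = k ` line l"
      have gkH: "g \<in> H" "k \<in> H" using gk S_H by blast+
      have "(inv\<^bsub>G\<^esub> g \<otimes>\<^bsub>G\<^esub> k) ` line l = line l"
        using mult_image[OF inv_H[OF gkH(1)] gkH(2) lP] inv_image[OF gkH(1) lP] gk(3) by simp
      hence "inv\<^bsub>G\<^esub> g \<otimes>\<^bsub>G\<^esub> k \<in> A l" using A_image[OF l] mult_H[OF inv_H] gkH by blast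
      moreover have "inv\<^bsub>G\<^esub> g \<otimes>\<^bsub>G\<^esub> k \<in> S"
        using gk normal_imp_subgroup[OF S_normal] by (meson subgroup.m_closed subgroup.m_inv_closed)
      ultimately have "inv\<^bsub>G\<^esub> g \<otimes>\<^bsub>G\<^esub> k = \<one>\<^bsub>G\<^esub>" using A_inter_S[OF l] by blast
      hence "g \<otimes>\<^bsub>G\<^esub> (inv\<^bsub>G\<^esub> g \<otimes>\<^bsub>G\<^esub> k) = g" using gkH r_one[of g] by simp
      moreover have "g \<otimes>\<^bsub>G\<^esub> (inv\<^bsub>G\<^esub> g \<otimes>\<^bsub>G\<^esub> k) = k"
        by (rule inv_cancel_left(1)) (simp_all add: gkH)
      ultimately show "g = k" by metis
    qed
    have finT: "finite ?T" using card_pencil[OF foot(3)[OF l]] by (intro finite_Diff) (auto intro: card_ge_0_finite)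
    have "card ?T = t"
      using card_pencil[OF foot(3)[OF l]] I_D[OF l] foot(1)[OF l] by (simp add: card_Diff_singleton)
    moreover have "(\<lambda>g. g ` line l) ` S \<subseteq> ?T" using mem S_H S_foot[OF l] by blast
    ultimately have "(\<lambda>g. g ` line l) ` S = ?T"
      using card_image[OF inj] card_S finT by (intro card_subset_eq) auto
    \<comment> \<open>Since \<open>S\<close> already reaches all \<open>t\<close> lines, some
      \<open>g\<close> in \<open>S\<close> moves \<open>line l\<close> exactly as \<open>h\<close>
      does, and then \<open>inv g\<close> times \<open>h\<close> stabilizes it.\<close>
    hence "h ` line l \<in> (\<lambda>g. g ` line l) ` S" using mem[OF h] by simp
    then obtain g where g: "g \<in> S" "g ` line l = h ` line l" by (elim imageE) simp
    have gH: "g \<in> H" using g S_H by blast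
    have "(inv\<^bsub>G\<^esub> g \<otimes>\<^bsub>G\<^esub> h) ` line l = line l"
      using mult_image[OF inv_H[OF gH] h(1) lP] inv_image[OF gH lP] g(2) by simp
    hence a: "inv\<^bsub>G\<^esub> g \<otimes>\<^bsub>G\<^esub> h \<in> A l" using A_image[OF l] mult_H[OF inv_H[OF gH] h(1)] by blast
    have "h = g \<otimes>\<^bsub>G\<^esub> (inv\<^bsub>G\<^esub> g \<otimes>\<^bsub>G\<^esub> h)"
      by (rule inv_cancel_left(1)[symmetric]) (simp_all add: gH h(1))
    hence "h \<in> S <#>\<^bsub>G\<^esub> A l" using g(1) a unfolding set_mult_def by blast
    thus "h \<in> A l <#>\<^bsub>G\<^esub> S" using commut_normal[OF A_subgroup[OF l] S_normal] by simp
  qed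
qed

text \<open>The point \<open>g z\<close> is projected onto \<open>line l\<close>. The projection is
  \<open>a z\<close> for a unique \<open>a\<close> in \<open>A l\<close>, and applying the inverse
  of \<open>a\<close> gives a point collinear with \<open>z\<close>, whose joining line determines
  \<open>k\<close>.\<close>

lemma factor_unique:
  assumes l: "l \<in> I" and g: "g \<in> H" "g (foot l) \<noteq> foot l"
  shows "card {(k, a). k \<in> I - {l} \<and> a \<in> A l \<and> inv\<^bsub>G\<^esub> a \<otimes>\<^bsub>G\<^esub> g \<in> A k} = 1"
proof -
  have gz: "g z \<in> P" "\<not> col x (g z)" using H_z g(1) by blast+
  have gA: "g \<notin> A l" using A_foot[OF l] g(2) by blast
  have gl: "g z \<notin> line l" using gA g(1) by (simp add: A_def)
  obtain w where w: "w \<in> line l" "col (g z) w" using project[OF gz(1) line(1)[OF l] gl] by blast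
  \<comment> \<open>Because \<open>g\<close> moves the foot, the projection \<open>w\<close> is a
    different point and hence in the orbit of \<open>z\<close>.\<close>
  have "\<not> col (g z) (foot l)" using foot_fixed_iff[OF l g(1)] g(2) by blast
  hence "w \<noteq> foot l" using w(2) by metis
  hence "\<not> col x w" "w \<in> P" using line_col_unique[OF l w(1)] w(1) line_sub[OF line(1)[OF l]] by blast+
  then obtain a where a: "a \<in> H" "a z = w" using H_sharp[OF zP _ z_noncol] by blast
  have aA: "a \<in> A l" using a w(1) by (simp add: A_def)
  have "col z ((inv\<^bsub>G\<^esub> a \<otimes>\<^bsub>G\<^esub> g) z)"
    using H_col[OF inv_H[OF a(1)] w(2)] a inv_apply(1)[OF a(1) zP] mult_apply[OF inv_H[OF a(1)] g(1) zP]
      col_sym by metis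
  then obtain m where m: "m \<in> L" "z \<in> m" "(inv\<^bsub>G\<^esub> a \<otimes>\<^bsub>G\<^esub> g) z \<in> m" by (rule colE)
  then obtain k where k: "k \<in> I" "m = line k" using line_surj by blast
  have agk: "inv\<^bsub>G\<^esub> a \<otimes>\<^bsub>G\<^esub> g \<in> A k" using m(3) k(2) mult_H[OF inv_H[OF a(1)] g(1)] by (simp add: A_def)
  have notA: "inv\<^bsub>G\<^esub> b \<otimes>\<^bsub>G\<^esub> g \<notin> A l" if "b \<in> A l" for b
    using subgroup_inv_mult_mem_iff[OF A_subgroup[OF l] that, of g] g(1) gA by simp
  have "k \<noteq> l" using agk notA[OF aA] by blast
  have uniq: "k' = k \<and> b = a"
    if kb: "k' \<in> I" "b \<in> A l" "inv\<^bsub>G\<^esub> b \<otimes>\<^bsub>G\<^esub> g \<in> A k'" for k' b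
  proof -
    have bH: "b \<in> H" using kb A_H by blast
    have "col z ((inv\<^bsub>G\<^esub> b \<otimes>\<^bsub>G\<^esub> g) z)"
      using kb(3) colI[OF line(1)[OF kb(1)] line(2)[OF kb(1)]] by (simp add: A_def)
    hence "col (b z) (b ((inv\<^bsub>G\<^esub> b \<otimes>\<^bsub>G\<^esub> g) z))" by (rule H_col[OF bH])
    hence "col (b z) (g z)"
      using mult_apply[OF inv_H[OF bH] g(1) zP] inv_apply(2)[OF bH gz(1)] by simp
    moreover have "b z \<in> line l" using kb(2) by (simp add: A_def)
    ultimately have "b z = w"
      using no_triangle[OF line(1)[OF l] gz(1) _ w(1) _ w(2) gl] col_sym by blast
    hence ba: "b = a" using H_z_inj[OF bH a(1)] a(2) by simp
    let ?p = "(inv\<^bsub>G\<^esub> a \<otimes>\<^bsub>G\<^esub> g) z"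
    have "?p \<noteq> z"
    proof
      assume "?p = z"
      hence "inv\<^bsub>G\<^esub> a \<otimes>\<^bsub>G\<^esub> g \<in> A l"
        using mult_H[OF inv_H[OF a(1)] g(1)] line(2)[OF l] by (simp add: A_def)
      thus False using notA[OF aA] by blast
    qed
    moreover have "?p \<in> line k'" "?p \<in> line k" using kb(3) agk ba by (auto simp: A_def)
    ultimately have "line k' = line k"
      using line_unique[OF line(1)[OF kb(1)] line(1)[OF k(1)] line(2)[OF kb(1)] _ line(2)[OF k(1)]] by metis
    thus ?thesis using line_inj[OF kb(1) k(1)] ba by blast
  qed
  have "{(k, a). k \<in> I - {l} \<and> a \<in> A l \<and> inv\<^bsub>G\<^esub> a \<otimes>\<^bsub>G\<^esub> g \<in> A k} = {(k, a)}"
  proof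
    show "{(k, a)} \<subseteq> {(k, a). k \<in> I - {l} \<and> a \<in> A l \<and> inv\<^bsub>G\<^esub> a \<otimes>\<^bsub>G\<^esub> g \<in> A k}"
      using k(1) \<open>k \<noteq> l\<close> aA agk by blast
    show "{(k, a). k \<in> I - {l} \<and> a \<in> A l \<and> inv\<^bsub>G\<^esub> a \<otimes>\<^bsub>G\<^esub> g \<in> A k} \<subseteq> {(k, a)}"
      using uniq by blast
  qed
  thus ?thesis by (metis card_1_singleton_iff One_nat_def)
qed

section \<open>The Kantor family and normality of its tangent subgroups\<close>

lemma kantor_family_stabilizers: "kantor_family G S I A s t"
proof (rule kantor_family.intro[OF is_group kantor_family_axioms.intro])
  show "finite (carrier G)"
  proof -
    have "inj_on (\<lambda>h. h z) H" using H_z_inj by (auto intro!: inj_onI)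
    moreover have "(\<lambda>h. h z) ` H \<subseteq> P" using H_z(1) by blast
    ultimately show ?thesis using finP by (simp add: inj_on_finite)
  qed
  fix l assume l: "l \<in> I"
  show "A l \<inter> S = {\<one>\<^bsub>G\<^esub>}" by (rule A_inter_S[OF l])
  show "subgroup (A l) G" "card (A l) = s" by (rule A_subgroup[OF l], rule card_A[OF l])
  show "card {(j, a). j \<in> I - {l} \<and> a \<in> A l \<and> inv\<^bsub>G\<^esub> a \<otimes>\<^bsub>G\<^esub> g \<in> A j} = 1"
    if "g \<in> carrier G" "g \<notin> A l <#>\<^bsub>G\<^esub> S" for g
    using factor_unique[OF l, of g] that unfolding A_S_eq_stabilizer[OF l] by simp
  show "(A l <#>\<^bsub>G\<^esub> S) \<inter> A k = {\<one>\<^bsub>G\<^esub>}" if k: "k \<in> I" "l \<noteq> k" for k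
  proof
    show "(A l <#>\<^bsub>G\<^esub> S) \<inter> A k \<subseteq> {\<one>\<^bsub>G\<^esub>}"
      unfolding A_S_eq_stabilizer[OF l] using fixed_foot_A_one[OF l k] by blast
    have "\<one>\<^bsub>G\<^esub> \<in> H" "\<one>\<^bsub>G\<^esub> (foot l) = foot l" using one_closed one_apply[OF foot(3)[OF l]] by simp_all
    thus "{\<one>\<^bsub>G\<^esub>} \<subseteq> (A l <#>\<^bsub>G\<^esub> S) \<inter> A k"
      unfolding A_S_eq_stabilizer[OF l] using subgroup.one_closed[OF A_subgroup[OF k(1)]] by blast
  qed
qed (rule S_normal card_S card_I s_gt t_gt)+

text \<open>The tangent subgroup is the stabilizer of the foot. The property makes its elements fix
  \<open>l\<close> pointwise, and since \<open>H\<close> stabilizes \<open>l\<close>, conjugates fix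
  the foot as well.\<close>

lemma stabilizer_normal:
  assumes star: "property_star P L x H" and l: "l \<in> I"
  shows "A l <#>\<^bsub>G\<^esub> S \<lhd> G"
proof -
  interpret kantor_family G S I A s t by (rule kantor_family_stabilizers)
  have "subgroup (A l <#>\<^bsub>G\<^esub> S) G" using B_sub[OF l] by (simp add: B_def)
  moreover have "g \<otimes>\<^bsub>G\<^esub> h \<otimes>\<^bsub>G\<^esub> inv\<^bsub>G\<^esub> g \<in> A l <#>\<^bsub>G\<^esub> S"
    if g: "g \<in> H" and h: "h \<in> A l <#>\<^bsub>G\<^esub> S" for g h
  proof -
    have hH: "h \<in> H" "h (foot l) = foot l" using h unfolding A_S_eq_stabilizer[OF l] by blast+
    note gi = inv_H[OF g]
    have fixed: "\<forall>p\<in>l. h p = p"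
      using star foot[OF l] hH I_D[OF l] unfolding property_star_def by blast
    have il: "(inv\<^bsub>G\<^esub> g) (foot l) \<in> l" by (rule foot_moved(1)[OF l gi])
    have iP: "(inv\<^bsub>G\<^esub> g) (foot l) \<in> P" by (rule H_closed[OF gi foot(3)[OF l]])
    have "(g \<otimes>\<^bsub>G\<^esub> h \<otimes>\<^bsub>G\<^esub> inv\<^bsub>G\<^esub> g) (foot l) = g (h ((inv\<^bsub>G\<^esub> g) (foot l)))"
      using mult_apply[OF mult_H[OF g hH(1)] gi foot(3)[OF l]] mult_apply[OF g hH(1) iP] by simp
    also have "\<dots> = foot l" using fixed il inv_apply(2)[OF g foot(3)[OF l]] by simp
    finally show ?thesis unfolding A_S_eq_stabilizer[OF l] using mult_H[OF mult_H[OF g hH(1)] gi] by blast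
  qed
  ultimately show ?thesis by (simp add: normal_inv_iff)
qed

end

theorem mainTheorem17:
  fixes P :: "'p set" and L :: "'p set set" and s t :: nat and x :: 'p
    and H S :: "('p \<Rightarrow> 'p) set"
  assumes "skew_translation_GQ P L s t x H S"
    and "(s = t \<and> odd s) \<or> (s \<noteq> t \<and> property_star P L x H)"
  shows "\<forall>M. subgroup M (BijGroup P) \<and> M \<subseteq> H \<and> M <#>\<^bsub>BijGroup P\<^esub> S = H \<longrightarrow> M = H"
proof (intro allI impI, elim conjE)
  fix M assume M: "subgroup M (BijGroup P)" "M \<subseteq> H" "M <#>\<^bsub>BijGroup P\<^esub> S = H"
  interpret skew_translation_quadrangle P L s t x H S by unfold_locales (rule assms(1))
  interpret K: kantor_family G S I A s t by (rule kantor_family_stabilizers)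
  interpret K: normal_kantor_family G S I A s t
  proof (rule normal_kantor_family.intro[OF kantor_family_stabilizers normal_kantor_family_axioms.intro])
    fix l assume l: "l \<in> I"
    show "K.B l \<lhd> G"
    proof (cases "s = t")
      case True thus ?thesis by (rule K.B_normal_if_eq[OF _ l])
    next
      case False
      hence "property_star P L x H" using assms(2) by blast
      thus ?thesis unfolding K.B_def by (rule stabilizer_normal[OF _ l])
    qed
  qed
  have "s = t \<and> odd s \<or> s \<noteq> t" using assms(2) by blast
  moreover have "subgroup M G"
    by (rule group.subgroup_incl[OF group_BijGroup M(1) H_sub M(2)])
  moreover have "M <#>\<^bsub>G\<^esub> S = carrier G" using M(3) by simp
  ultimately have "M = carrier G" by (rule K.supplement_eq_carrier)
  thus "M = H" by simp
qed

end
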